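(* Let $K$ be a separable Hilbert space and, for each small region $\mathcal O\subset\mathcal M$, let $W_{\mathcal O}(y,x)$, $x,y\in\mathcal O$, be unitary operators in $K$ satisfying $$W_{\mathcal O}(y,x)W_{\mathcal O}(x,z)=W_{\mathcal O}(y,z),\quad W_{\mathcal O}(y,x)=W_{\mathcal O}(x,y)^{-1},\qquad W_{\mathcal O_1}(y,x)=W_{\mathcal O_2}(y,x)\ \ \forall x,y\in\mathcal O_1\subset\mathcal O_2 .$$ (1) Given $x,y\in\mathcal M$, a regular path $\gamma(y,x)$ starting at $x$ and ending at $y$, a partition $\gamma=\gamma_n(y,x_{n-1})\circ\dots\circ\gamma_1(x_1,x)$ and small regions $\mathcal O_i\supset\gamma_i$, $i=1,\dots,n$, the operators $$W(y,x,\gamma)=W_{\mathcal O_n}(y,x_{n-1})\,W_{\mathcal O_{n-1}}(x_{n-1},x_{n-2})\cdots W_{\mathcal O_1}(x_1,x)$$ only depend on $x,y$ and on the homotopy class $[\gamma]$ of $\gamma(y,x)$. They satisfy the composition law $$W(y,x,[\gamma])\,W(x,z,[\delta])=W(y,z,[\gamma]\circ[\delta]).$$ For almost all $x$, the operators $W(x,x,[\gamma])$ provide a unitary representation $\mathcal R^x([\gamma])$ of $\pi_1(\mathcal M)$, all belonging to the same equivalence class $[\mathcal R]$. (2) Two systems of (weakly measurable) unitary operators $W_1(y,x,[\gamma])$, $W_2(y,x,[\gamma])$ satisfying the composition law $$W_i(y,x,[\gamma])\,W_i(x,z,[\delta])=W_i(y,z,[\gamma]\circ[\delta]),\qquad i=1,2,$$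 are related by (weakly measurable) unitaries $S(z)$, $z\in\mathcal M$, $$W_2(y,x,[\gamma])=S(y)\,W_1(y,x,[\gamma])\,S(x)^{-1},$$ if and only if, for some (and then for all) $x\in\mathcal M$, the corresponding systems for closed paths, $\mathcal R_i^x([\gamma])=W_i(x,x,[\gamma])$, are unitarily equivalent, $$\mathcal R_2^x([\gamma])=S(x)\,\mathcal R_1^x([\gamma])\,S^{-1}(x),$$ equivalently, if and only if the corresponding equivalence classes $[\mathcal R_i]$, $i=1,2$, coincide.
   Context: $\mathcal M$ is a connected (second countable) $C^\infty$ manifold of dimension $d$. An open $\mathcal O\subset\mathcal M$ is *small* if there are an open neighbourhood $\mathcal O'$ of $\mathcal O$ and a diffeomorphism of $\mathcal O'$ onto $\{y\in\mathbb R^d:|y|<1\}$ taking $\mathcal O$ onto $\{|y|<1/2\}$. Almost everywhere and measurability refer to the Lebesgue measure class on $\mathcal M$. $\gamma(y,x)$ denotes a path from $x$ to $y$; $\gamma(y,x)\circ\delta(x,z)$ means first $\delta$, then $\gamma$; homotopy is with fixed endpoints; regular paths may be taken piecewise smooth. Weak measurability of a system $W(y,x,[\gamma])$ refers to its dependence on the endpoints $y,x$ (for paths varying continuously with the endpoints, e.g. for paths inside a small region). $\pi_1(\mathcal M)$ for $W(x,x,\cdot)$ has base point $x$; fundamental groups at different base points are identified by $[\gamma]\mapsto[\delta^{-1}\circ\gamma\circ\delta]$, $\delta$ a path from the new base point to the old one, and equivalence classes of unitary representations are compared through such identifications. *)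

theory Defs
  imports "HOL-Analysis.Analysis" "HOL-Algebra.Group"
begin

section \<open>Complex Hilbert spaces and unitary operators\<close>

text \<open>The inner product is conjugate linear in the first argument. Completeness comes
  from the superclass \<open>banach\<close>; separability is a hypothesis of the theorem.\<close>

class complex_hilbert_space = banach +
  fixes scaleC :: "complex \<Rightarrow> 'a \<Rightarrow> 'a"
    and cinner :: "'a \<Rightarrow> 'a \<Rightarrow> complex"
  assumes scaleC_add_right: "scaleC a (x + y) = scaleC a x + scaleC a y"
    and scaleC_add_left: "scaleC (a + b) x = scaleC a x + scaleC b x"
    and scaleC_scaleC: "scaleC a (scaleC b x) = scaleC (a * b) x"
    and scaleC_of_real: "scaleC (complex_of_real r) x = scaleR r x"
    and cinner_commute: "cinner x y = cnj (cinner y x)"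
    and cinner_add_right: "cinner x (y + z) = cinner x y + cinner x z"
    and cinner_scaleC_right: "cinner x (scaleC a y) = a * cinner x y"
    and cinner_same: "cinner x x = complex_of_real ((norm x)\<^sup>2)"

definition unitary :: "('k::complex_hilbert_space \<Rightarrow> 'k) \<Rightarrow> bool" where
  "unitary U \<longleftrightarrow>
     (\<forall>x y. U (x + y) = U x + U y) \<and>
     (\<forall>a x. U (scaleC a x) = scaleC a (U x)) \<and>
     (\<forall>x y. cinner (U x) (U y) = cinner x y) \<and>
     surj U"

text \<open>The notation \<open>inv\<close> is taken by the group inverse of HOL-Algebra.\<close>

abbreviation inv_op :: "('k \<Rightarrow> 'k) \<Rightarrow> 'k \<Rightarrow> 'k" where
  "inv_op \<equiv> inv_into UNIV"

definition unitary_group :: "('k::complex_hilbert_space \<Rightarrow> 'k) monoid" where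
  "unitary_group = \<lparr>carrier = {U. unitary U}, mult = (\<circ>), one = id\<rparr>"


section \<open>Smooth manifolds\<close>

text \<open>Class $C^k$ on an open set, for a finite-dimensional domain: the directional
  derivatives in all fixed directions are required to be of class $C^{k-1}$.\<close>

primrec Ck_on :: "nat \<Rightarrow> ('a::real_normed_vector \<Rightarrow> 'b::real_normed_vector) \<Rightarrow> 'a set \<Rightarrow> bool" where
  "Ck_on 0 f S \<longleftrightarrow> continuous_on S f"
| "Ck_on (Suc k) f S \<longleftrightarrow>
     (\<forall>x\<in>S. f differentiable (at x)) \<and>
     (\<forall>v. Ck_on k (\<lambda>x. frechet_derivative f (at x) v) S)"

definition smooth_on :: "'a::real_normed_vector set \<Rightarrow> ('a \<Rightarrow> 'b::real_normed_vector) \<Rightarrow> bool" where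
  "smooth_on S f \<longleftrightarrow> (\<forall>k. Ck_on k f S)"

text \<open>The manifold is the whole (Hausdorff, second countable) type \<open>'m\<close>, with its smooth
  structure given by an atlas. A chart is a pair of its domain and its coordinate map; the
  values of the coordinate map outside the domain are irrelevant.\<close>

type_synonym ('m, 'e) chart = "'m set \<times> ('m \<Rightarrow> 'e)"

definition is_chart :: "('m::topological_space, 'e::euclidean_space) chart \<Rightarrow> bool" where
  "is_chart = (\<lambda>(U, \<phi>). open U \<and> open (\<phi> ` U) \<and> (\<exists>\<psi>. homeomorphism U (\<phi> ` U) \<phi> \<psi>))"

definition smooth_transition ::
  "('m::topological_space, 'e::euclidean_space) chart \<Rightarrow> ('m, 'e) chart \<Rightarrow> bool" where
  "smooth_transition = (\<lambda>(U, \<phi>) (V, \<psi>). smooth_on (\<phi> ` (U \<inter> V)) (\<psi> \<circ> inv_into U \<phi>))"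

definition smooth_atlas :: "('m::topological_space, 'e::euclidean_space) chart set \<Rightarrow> bool" where
  "smooth_atlas A \<longleftrightarrow>
     (\<forall>c\<in>A. is_chart c) \<and> (\<Union>c\<in>A. fst c) = UNIV \<and>
     (\<forall>c\<in>A. \<forall>c'\<in>A. smooth_transition c c')"

text \<open>A diffeomorphism of an open subset \<open>U\<close> of the manifold onto an open subset \<open>B\<close> of the
  model space.\<close>

definition diffeo_onto ::
  "('m::topological_space, 'e::euclidean_space) chart set \<Rightarrow> 'm set \<Rightarrow> ('m \<Rightarrow> 'e) \<Rightarrow> 'e set \<Rightarrow> bool" where
  "diffeo_onto A U f B \<longleftrightarrow>
     is_chart (U, f) \<and> f ` U = B \<and>
     (\<forall>c\<in>A. smooth_transition c (U, f) \<and> smooth_transition (U, f) c)"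

definition small_region ::
  "('m::topological_space, 'e::euclidean_space) chart set \<Rightarrow> 'm set \<Rightarrow> bool" where
  "small_region A R \<longleftrightarrow>
     open R \<and> (\<exists>R' f. R \<subseteq> R' \<and> diffeo_onto A R' f (ball 0 1) \<and> f ` R = ball 0 (1/2))"


section \<open>The Lebesgue measure class\<close>

definition lebesgue_null ::
  "('m::topological_space, 'e::euclidean_space) chart set \<Rightarrow> 'm set \<Rightarrow> bool" where
  "lebesgue_null A N \<longleftrightarrow> (\<forall>(U, \<phi>)\<in>A. \<phi> ` (N \<inter> U) \<in> null_sets lebesgue)"

definition almost_all ::
  "('m::topological_space, 'e::euclidean_space) chart set \<Rightarrow> ('m \<Rightarrow> bool) \<Rightarrow> bool" where
  "almost_all A P \<longleftrightarrow> lebesgue_null A {x. \<not> P x}"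

text \<open>Only the \<open>\<sigma>\<close>-algebra of this measure is used (its \<open>emeasure\<close> is zero).\<close>

definition lebesgue_sets ::
  "('m::topological_space, 'e::euclidean_space) chart set \<Rightarrow> 'm measure" where
  "lebesgue_sets A = sigma UNIV {S. \<forall>(U, \<phi>)\<in>A. \<phi> ` (S \<inter> U) \<in> sets lebesgue}"

definition prod_atlas ::
  "('m, 'e) chart set \<Rightarrow> ('n, 'f) chart set \<Rightarrow> ('m \<times> 'n, 'e \<times> 'f) chart set" where
  "prod_atlas A B = {(U \<times> V, map_prod \<phi> \<psi>) | U \<phi> V \<psi>. (U, \<phi>) \<in> A \<and> (V, \<psi>) \<in> B}"


section \<open>Paths, homotopy classes and the fundamental group\<close>

definition unit_partition :: "nat \<Rightarrow> (nat \<Rightarrow> real) \<Rightarrow> bool" where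
  "unit_partition n t \<longleftrightarrow> t 0 = 0 \<and> t n = 1 \<and> (\<forall>i<n. t i < t (Suc i))"

definition smooth_curve_on ::
  "('m::topological_space, 'e::euclidean_space) chart set \<Rightarrow> real set \<Rightarrow> (real \<Rightarrow> 'm) \<Rightarrow> bool" where
  "smooth_curve_on A T h \<longleftrightarrow>
     continuous_on T h \<and> (\<forall>(U, \<phi>)\<in>A. smooth_on (T \<inter> h -` U) (\<phi> \<circ> h))"

text \<open>Regular means piecewise smooth; on a closed parameter interval a curve is smooth if
  it extends to a smooth curve on an open neighbourhood of the interval.\<close>

definition regular_path ::
  "('m::topological_space, 'e::euclidean_space) chart set \<Rightarrow> (real \<Rightarrow> 'm) \<Rightarrow> bool" where
  "regular_path A g \<longleftrightarrow>
     path g \<and>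
     (\<exists>n t. unit_partition n t \<and>
        (\<forall>i<n. \<exists>T h. open T \<and> {t i..t (Suc i)} \<subseteq> T \<and> smooth_curve_on A T h \<and>
           (\<forall>s\<in>{t i..t (Suc i)}. h s = g s)))"

definition homotopy_class :: "(real \<Rightarrow> 'm::topological_space) \<Rightarrow> (real \<Rightarrow> 'm) set" where
  "homotopy_class g = {h. homotopic_paths UNIV g h}"

text \<open>Homotopy classes of paths from \<open>x\<close> to \<open>y\<close>.\<close>

definition path_classes :: "'m::topological_space \<Rightarrow> 'm \<Rightarrow> (real \<Rightarrow> 'm) set set" where
  "path_classes x y = {homotopy_class g | g. path g \<and> pathstart g = x \<and> pathfinish g = y}"

text \<open>The composite $[\gamma]\circ[\delta]$: first \<open>\<delta>\<close>, then \<open>\<gamma>\<close>, whereas \<open>+++\<close> traverses its left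
  operand first.\<close>

definition class_comp ::
  "(real \<Rightarrow> 'm::topological_space) set \<Rightarrow> (real \<Rightarrow> 'm) set \<Rightarrow> (real \<Rightarrow> 'm) set" where
  "class_comp c d = (\<Union>g\<in>c. \<Union>h\<in>d. homotopy_class (h +++ g))"

definition pi1 :: "'m::topological_space \<Rightarrow> (real \<Rightarrow> 'm) set monoid" where
  "pi1 x = \<lparr>carrier = path_classes x x, mult = class_comp, one = homotopy_class (\<lambda>_. x)\<rparr>"

text \<open>The identification of fundamental groups, $[\gamma]\mapsto[\delta^{-1}\circ\gamma\circ\delta]$, where \<open>\<delta>\<close>
  runs from the new base point to the old one.\<close>

definition change_base :: "(real \<Rightarrow> 'm::topological_space) \<Rightarrow> (real \<Rightarrow> 'm) set \<Rightarrow> (real \<Rightarrow> 'm) set" where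
  "change_base \<delta> c =
     class_comp (homotopy_class (reversepath \<delta>)) (class_comp c (homotopy_class \<delta>))"


section \<open>Unitary representations of the fundamental group\<close>

type_synonym ('m, 'k) pi1_rep = "(real \<Rightarrow> 'm) set \<Rightarrow> 'k \<Rightarrow> 'k"

text \<open>Representations are recorded together with their base point.\<close>

definition based_reps ::
  "('m::topological_space \<times> ('m, 'k::complex_hilbert_space) pi1_rep) set" where
  "based_reps = {(x, R). R \<in> hom (pi1 x) unitary_group}"

definition rep_equiv ::
  "(('m::topological_space \<times> ('m, 'k::complex_hilbert_space) pi1_rep) \<times>
    ('m \<times> ('m, 'k) pi1_rep)) set" where
  "rep_equiv = {((x, R), (x', R')).
     (x, R) \<in> based_reps \<and> (x', R') \<in> based_reps \<and>
     (\<exists>\<delta> V. path \<delta> \<and> pathstart \<delta> = x' \<and> pathfinish \<delta> = x \<and> unitary V \<and>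
        (\<forall>c\<in>carrier (pi1 x). R' (change_base \<delta> c) = V \<circ> R c \<circ> inv_op V))}"


section \<open>Transport systems\<close>

text \<open>The operators $W_{\mathcal O}(y,x)$ are written \<open>w R y x\<close>, with \<open>R\<close> the small region.\<close>

definition local_system ::
  "('m::topological_space, 'e::euclidean_space) chart set \<Rightarrow>
   ('m set \<Rightarrow> 'm \<Rightarrow> 'm \<Rightarrow> 'k::complex_hilbert_space \<Rightarrow> 'k) \<Rightarrow> bool" where
  "local_system A w \<longleftrightarrow>
     (\<forall>R. small_region A R \<longrightarrow> (\<forall>x\<in>R. \<forall>y\<in>R. unitary (w R y x))) \<and>
     (\<forall>R. small_region A R \<longrightarrow> (\<forall>x\<in>R. \<forall>y\<in>R. \<forall>z\<in>R. w R y x \<circ> w R x z = w R y z)) \<and>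
     (\<forall>R. small_region A R \<longrightarrow> (\<forall>x\<in>R. \<forall>y\<in>R. w R y x = inv_op (w R x y))) \<and>
     (\<forall>R\<^sub>1 R\<^sub>2. small_region A R\<^sub>1 \<longrightarrow> small_region A R\<^sub>2 \<longrightarrow> R\<^sub>1 \<subseteq> R\<^sub>2 \<longrightarrow>
        (\<forall>x\<in>R\<^sub>1. \<forall>y\<in>R\<^sub>1. w R\<^sub>1 y x = w R\<^sub>2 y x))"

text \<open>A partition of \<open>g\<close> with its \<open>i\<close>-th piece (counted from 0) inside the small region \<open>R i\<close>,
  and the corresponding ordered product of operators.\<close>

definition small_subdivision ::
  "('m::topological_space, 'e::euclidean_space) chart set \<Rightarrow>
   (real \<Rightarrow> 'm) \<Rightarrow> nat \<Rightarrow> (nat \<Rightarrow> real) \<Rightarrow> (nat \<Rightarrow> 'm set) \<Rightarrow> bool" where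
  "small_subdivision A g n t R \<longleftrightarrow>
     unit_partition n t \<and>
     (\<forall>i<n. small_region A (R i) \<and> g ` {t i..t (Suc i)} \<subseteq> R i)"

primrec path_product ::
  "('m set \<Rightarrow> 'm \<Rightarrow> 'm \<Rightarrow> 'k \<Rightarrow> 'k) \<Rightarrow>
   (real \<Rightarrow> 'm) \<Rightarrow> (nat \<Rightarrow> real) \<Rightarrow> (nat \<Rightarrow> 'm set) \<Rightarrow> nat \<Rightarrow> 'k \<Rightarrow> 'k" where
  "path_product w g t R 0 = id"
| "path_product w g t R (Suc i) = w (R i) (g (t (Suc i))) (g (t i)) \<circ> path_product w g t R i"

text \<open>The operators $W(y,x,[\gamma])$ are written \<open>W y x c\<close>; the values for \<open>c\<close> not a class of
  paths from \<open>x\<close> to \<open>y\<close> are irrelevant.\<close>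

type_synonym ('m, 'k) transport = "'m \<Rightarrow> 'm \<Rightarrow> (real \<Rightarrow> 'm) set \<Rightarrow> 'k \<Rightarrow> 'k"

definition transport_system ::
  "('m::topological_space, 'k::complex_hilbert_space) transport \<Rightarrow> bool" where
  "transport_system W \<longleftrightarrow>
     (\<forall>x y. \<forall>c\<in>path_classes x y. unitary (W y x c)) \<and>
     (\<forall>x y z. \<forall>c\<in>path_classes x y. \<forall>d\<in>path_classes z x.
        W y x c \<circ> W x z d = W y z (class_comp c d))"

text \<open>Weak measurability of $W$ in the endpoints: the matrix elements are measurable along every
  family of paths \<open>\<Gamma> (y, x)\<close> from \<open>x\<close> to \<open>y\<close> that varies continuously with \<open>(y, x)\<close> in an open
  set of pairs.\<close>

definition weakly_measurable_transport ::
  "('m::topological_space, 'e::euclidean_space) chart set \<Rightarrow>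
   ('m, 'k::complex_hilbert_space) transport \<Rightarrow> bool" where
  "weakly_measurable_transport A W \<longleftrightarrow>
     (\<forall>V \<Gamma>. open V \<longrightarrow>
        continuous_on (V \<times> {0..1}) (\<lambda>(p, s). \<Gamma> p s) \<longrightarrow>
        (\<forall>(y, x)\<in>V. pathstart (\<Gamma> (y, x)) = x \<and> pathfinish (\<Gamma> (y, x)) = y) \<longrightarrow>
        (\<forall>\<xi> \<eta>. (\<lambda>(y, x). cinner \<xi> (W y x (homotopy_class (\<Gamma> (y, x))) \<eta>))
           \<in> borel_measurable (restrict_space (lebesgue_sets (prod_atlas A A)) V)))"

definition weakly_measurable ::
  "('m::topological_space, 'e::euclidean_space) chart set \<Rightarrow>
   ('m \<Rightarrow> 'k::complex_hilbert_space \<Rightarrow> 'k) \<Rightarrow> bool" where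
  "weakly_measurable A S \<longleftrightarrow>
     (\<forall>\<xi> \<eta>. (\<lambda>z. cinner \<xi> (S z \<eta>)) \<in> borel_measurable (lebesgue_sets A))"

definition loop_rep :: "('m, 'k) transport \<Rightarrow> 'm \<Rightarrow> ('m, 'k) pi1_rep" where
  "loop_rep W x = W x x"

text \<open>With $\mathcal R^x$ = \<open>loop_rep W x\<close>, this is the class $[\mathcal R]$: all based representations equivalent to one of the $\mathcal R^x$.
  For a transport system on a path-connected space the $\mathcal R^x$ are mutually equivalent, so
  this is a single class of \<open>rep_equiv\<close>.\<close>

definition loop_rep_class ::
  "('m::topological_space, 'k::complex_hilbert_space) transport \<Rightarrow> ('m \<times> ('m, 'k) pi1_rep) set" where
  "loop_rep_class W = rep_equiv `` range (\<lambda>x. (x, loop_rep W x))"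

definition loop_reps_equivalent_at ::
  "('m::topological_space, 'k::complex_hilbert_space) transport \<Rightarrow> ('m, 'k) transport \<Rightarrow> 'm \<Rightarrow> bool" where
  "loop_reps_equivalent_at W\<^sub>1 W\<^sub>2 x \<longleftrightarrow>
     (\<exists>V. unitary V \<and>
        (\<forall>c\<in>carrier (pi1 x). loop_rep W\<^sub>2 x c = V \<circ> loop_rep W\<^sub>1 x c \<circ> inv_op V))"

definition measurably_equivalent ::
  "('m::topological_space, 'e::euclidean_space) chart set \<Rightarrow>
   ('m, 'k::complex_hilbert_space) transport \<Rightarrow> ('m, 'k) transport \<Rightarrow> bool" where
  "measurably_equivalent A W\<^sub>1 W\<^sub>2 \<longleftrightarrow>
     (\<exists>S. (\<forall>z. unitary (S z)) \<and> weakly_measurable A S \<and>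
        (\<forall>x y. \<forall>c\<in>path_classes x y. W\<^sub>2 y x c = S y \<circ> W\<^sub>1 y x c \<circ> inv_op (S x)))"

end

theory Submission
  imports Defs
begin

text \<open>The operators of a local system are bijections forming a cocycle over a basis of the
  topology, so over any continuous \<open>f\<close> one can speak of covariantly constant (horizontal)
  sections; on a connected parameter space such a section is determined by one value. A path cut
  into small pieces carries the section given by the partial products, which is therefore
  independent of the partition; over a thin strip of a homotopy the same construction works, and
  the section is constant along the two fixed ends, so the holonomy is locally constant, hence
  constant, in the homotopy parameter.

  In the second part the intertwiner $V$ at one base point is transported to
  $S(z) = W_2(z,x,[\gamma])\,V\,W_1(z,x,[\gamma])^{-1}$, which does not depend on $\gamma$ because
  $V$ intertwines the loop representations. Weak measurability of $W_i$ is joint measurability in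
  a Lebesgue $\sigma$-algebra of pairs, so by Fubini only almost every endpoint $y$ gives a
  measurable slice $x \mapsto W_i(y,x)$; this suffices, since locally $S$ is determined by its
  value at one such $y$.\<close>

subsection \<open>Unitary operators\<close>

text \<open>Two small regions may meet in a disconnected set, while compatibility is assumed only
  for nested regions; so on an overlap the two families of operators can be compared only locally,
  inside smaller regions. This is why horizontality is a condition near each point. The operators
  are also not assumed continuous in their endpoints: horizontality is an exact equation with all
  nearby values, and topology enters only through the parameter space and the manifold. In the
  second part the null set of bad endpoints depends on the matrix element; separability of the
  Hilbert space leaves countably many of them, so one endpoint serves all matrix elements of both
  systems. The paths in the formula for \<open>S\<close> are chosen with no regularity in their
  endpoint \<open>z\<close>, so measurability cannot be read off that formula. It is drawn from the
  intertwining relation instead, along chart segments, which do vary continuously.\<close>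

lemma cinner_add_left: "cinner (x + y) z = cinner x z + cinner y z"
  by (metis cinner_add_right cinner_commute complex_cnj_add)

lemma cinner_diff_right: "cinner x (y - z) = cinner x y - cinner x z"
  by (metis cinner_add_right diff_add_cancel eq_diff_eq)

lemma scaleC_diff_right: "scaleC a (x - y) = scaleC a x - scaleC a y"
  by (metis scaleC_add_right diff_add_cancel eq_diff_eq)

lemma norm_scaleC: "norm (scaleC a x) = cmod a * norm x"
proof -
  have "complex_of_real ((norm (scaleC a x))\<^sup>2) = a * cinner (scaleC a x) x"
    by (metis cinner_same cinner_scaleC_right)
  also have "cinner (scaleC a x) x = cnj a * complex_of_real ((norm x)\<^sup>2)"
    by (metis cinner_commute cinner_same cinner_scaleC_right complex_cnj_mult)
  also have "a * (cnj a * complex_of_real ((norm x)\<^sup>2)) = complex_of_real ((cmod a * norm x)\<^sup>2)"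
    using complex_norm_square[of a] by (simp add: power_mult_distrib flip: mult.assoc)
  finally have "(norm (scaleC a x))\<^sup>2 = (cmod a * norm x)\<^sup>2"
    using of_real_eq_iff by blast
  then show ?thesis by (simp add: power2_eq_iff_nonneg)
qed

text \<open>Polarization: with the inner product expressed by norms, its continuity follows from
  that of the norm.\<close>

lemma Re_cinner: "Re (cinner x y) = ((norm (x + y))\<^sup>2 - (norm x)\<^sup>2 - (norm y)\<^sup>2) / 2"
proof -
  have "complex_of_real ((norm (x + y))\<^sup>2) =
      of_real ((norm x)\<^sup>2) + of_real ((norm y)\<^sup>2) + cinner x y + cinner y x"
    by (simp only: flip: cinner_same) (simp add: cinner_add_left cinner_add_right)
  then have "Re (complex_of_real ((norm (x + y))\<^sup>2)) =
      Re (of_real ((norm x)\<^sup>2) + of_real ((norm y)\<^sup>2) + cinner x y + cinner y x)"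
    by simp
  moreover have "Re (cinner y x) = Re (cinner x y)"
    by (subst cinner_commute) simp
  ultimately show ?thesis by simp
qed

text \<open>The factor \<open>\<i>\<close> turns the imaginary part into a real part, to which
  polarization applies.\<close>

lemma Im_cinner: "Im (cinner x y) = - Re (cinner x (scaleC \<i> y))"
  by (simp add: cinner_scaleC_right)

lemma tendsto_scaleC_right:
  fixes f :: "'a \<Rightarrow> 'k::complex_hilbert_space"
  assumes "(f \<longlongrightarrow> l) F"
  shows "((\<lambda>x. scaleC a (f x)) \<longlongrightarrow> scaleC a l) F"
proof -
  have "((\<lambda>x. cmod a * norm (f x - l)) \<longlongrightarrow> cmod a * 0) F"
    using assms by (intro tendsto_mult_left) (simp add: LIM_zero_iff tendsto_norm_zero)
  then show ?thesis
    by (subst Lim_null, subst tendsto_norm_zero_iff[symmetric])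
      (simp flip: scaleC_diff_right add: norm_scaleC)
qed

lemma tendsto_cinner:
  fixes f g :: "'a \<Rightarrow> 'k::complex_hilbert_space"
  assumes "(f \<longlongrightarrow> a) F" "(g \<longlongrightarrow> b) F"
  shows "((\<lambda>x. cinner (f x) (g x)) \<longlongrightarrow> cinner a b) F"
  unfolding tendsto_complex_iff Im_cinner Re_cinner
  by (intro conjI tendsto_intros tendsto_scaleC_right assms) auto

lemma unitary_add: "unitary U \<Longrightarrow> U (x + y) = U x + U y"
  and unitary_scaleC: "unitary U \<Longrightarrow> U (scaleC a x) = scaleC a (U x)"
  and unitary_cinner: "unitary U \<Longrightarrow> cinner (U x) (U y) = cinner x y"
  and unitary_surj: "unitary U \<Longrightarrow> surj U"
  by (simp_all add: unitary_def)

lemma unitary_diff: "unitary U \<Longrightarrow> U (x - y) = U x - U y"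
  using unitary_add[of U "x - y" y] by simp

lemma unitary_norm: "unitary U \<Longrightarrow> norm (U x) = norm x"
  using unitary_cinner[of U x x] by (simp add: cinner_same power2_eq_iff_nonneg flip: of_real_power)

lemma unitary_bij:
  assumes "unitary U" shows "bij U"
proof -
  have "x = y" if "U x = U y" for x y
    using unitary_norm[OF assms, of "x - y"] that by (simp add: unitary_diff[OF assms])
  with unitary_surj[OF assms] show ?thesis by (auto intro!: bijI injI)
qed

lemma unitary_id: "unitary id"
  by (simp add: unitary_def)

lemma unitary_comp: "unitary U \<Longrightarrow> unitary V \<Longrightarrow> unitary (U \<circ> V)"
  unfolding unitary_def using comp_surj[of V U] by (simp add: comp_def)

lemma inv_op_right: "unitary U \<Longrightarrow> U (inv_op U x) = x"
  by (simp add: unitary_surj surj_f_inv_f)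

lemma inv_op_left: "unitary U \<Longrightarrow> inv_op U (U x) = x"
  by (simp add: unitary_bij bij_is_inj)

lemma inv_op_comp: "unitary U \<Longrightarrow> U \<circ> inv_op U = id" "unitary U \<Longrightarrow> inv_op U \<circ> U = id"
  by (auto simp: fun_eq_iff inv_op_left inv_op_right)

lemma unitary_inv_op:
  assumes U: "unitary U" shows "unitary (inv_op U)"
proof -
  let ?V = "inv_op U"
  have "?V (x + y) = ?V x + ?V y" for x y
    using inv_op_left[OF U, of "?V x + ?V y"] by (simp add: U unitary_add inv_op_right)
  moreover have "?V (scaleC a x) = scaleC a (?V x)" for a x
    using inv_op_left[OF U, of "scaleC a (?V x)"] by (simp add: U unitary_scaleC inv_op_right)
  moreover have "cinner (?V x) (?V y) = cinner x y" for x y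
    using unitary_cinner[OF U, of "?V x" "?V y"] by (simp add: U inv_op_right)
  moreover have "surj ?V"
    by (simp add: U bij_betw_imp_surj_on bij_imp_bij_inv unitary_bij)
  ultimately show ?thesis by (simp add: unitary_def)
qed

lemma inv_op_unique:
  assumes "unitary U" "U \<circ> V = id" shows "inv_op U = V"
proof
  fix x
  have "U (V x) = x" using assms(2) by (simp add: fun_eq_iff)
  then show "inv_op U x = V x" using inv_op_left[OF assms(1), of "V x"] by simp
qed

lemma cinner_unitary_right: "unitary U \<Longrightarrow> cinner x (U y) = cinner (inv_op U x) y"
  using unitary_cinner[of U "inv_op U x" y] by (simp add: inv_op_right)


subsection \<open>Small regions form a basis of the topology\<close>

lemma Ck_on_subset: "Ck_on k f S \<Longrightarrow> T \<subseteq> S \<Longrightarrow> Ck_on k f T"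
  by (induction k arbitrary: f) (auto intro: continuous_on_subset)

text \<open>A derivative at a point of \<open>S\<close> sees the function near that point; since
  \<open>S\<close> is open, equality on \<open>S\<close> passes to all directional derivatives and
  the induction continues.\<close>

lemma Ck_on_cong:
  assumes "open S" "\<And>x. x \<in> S \<Longrightarrow> f x = g x" "Ck_on k f S"
  shows "Ck_on k g S"
  using assms(2,3)
proof (induction k arbitrary: f g)
  case 0
  then show ?case using continuous_on_cong by force
next
  case (Suc k)
  have d: "f differentiable (at x)" if "x \<in> S" for x
    using Suc.prems(2) that by simp
  have "g differentiable (at x)" if "x \<in> S" for x
    using d[OF that] has_derivative_transform_within_open[OF _ \<open>open S\<close> that, of f _ UNIV g] Suc.prems(1)
    unfolding differentiable_def by blast
  moreover have "Ck_on k (\<lambda>x. frechet_derivative g (at x) v) S" for v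
  proof (rule Suc.IH)
    show "Ck_on k (\<lambda>x. frechet_derivative f (at x) v) S" using Suc.prems(2) by simp
    show "frechet_derivative f (at x) v = frechet_derivative g (at x) v" if "x \<in> S" for x
      using frechet_derivative_transform_within_open[OF d[OF that] \<open>open S\<close> that] Suc.prems(1) by metis
  qed
  ultimately show ?case by simp
qed

text \<open>The induction varies \<open>b\<close>, because differentiation replaces it by 0.\<close>

lemma Ck_on_affine_left:
  assumes "open S" "Ck_on k f S"
  shows "Ck_on k (\<lambda>x. a *\<^sub>R f x + b) S"
  using assms(2)
proof (induction k arbitrary: f b)
  case 0
  then show ?case by (auto intro!: continuous_intros)
next
  case (Suc k)
  have d: "((\<lambda>x. a *\<^sub>R f x + b) has_derivative (\<lambda>v. a *\<^sub>R frechet_derivative f (at x) v + 0)) (at x)"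
    if "x \<in> S" for x
    using Suc.prems that by (intro derivative_intros) (auto simp flip: frechet_derivative_works)
  have "Ck_on k (\<lambda>x. frechet_derivative (\<lambda>x. a *\<^sub>R f x + b) (at x) v) S" for v
  proof (rule Ck_on_cong[OF \<open>open S\<close>])
    show "Ck_on k (\<lambda>x. a *\<^sub>R frechet_derivative f (at x) v + 0) S"
      by (rule Suc.IH) (use Suc.prems in simp)
    show "a *\<^sub>R frechet_derivative f (at x) v + 0 = frechet_derivative (\<lambda>x. a *\<^sub>R f x + b) (at x) v"
      if "x \<in> S" for x
      using frechet_derivative_at[OF d[OF that]] by metis
  qed
  moreover have "\<forall>x\<in>S. (\<lambda>x. a *\<^sub>R f x + b) differentiable (at x)"
    using d unfolding differentiable_def by blast
  ultimately show ?case by simp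
qed

text \<open>Each derivative is again a function of \<open>a *\<^sub>R x + b\<close>, with the
  direction rescaled by \<open>a\<close>; so \<open>a\<close> and \<open>b\<close> stay fixed while
  \<open>f\<close> varies, and no general chain rule for \<open>Ck_on\<close> is required.\<close>

lemma Ck_on_affine_right:
  assumes "open T" "\<And>x. x \<in> T \<Longrightarrow> a *\<^sub>R x + b \<in> S" "Ck_on k f S"
  shows "Ck_on k (\<lambda>x. f (a *\<^sub>R x + b)) T"
  using assms(3)
proof (induction k arbitrary: f)
  case 0
  then show ?case using assms(2) by (auto intro!: continuous_on_compose2[of S f] continuous_intros)
next
  case (Suc k)
  have d: "((\<lambda>x. f (a *\<^sub>R x + b)) has_derivative (\<lambda>v. frechet_derivative f (at (a *\<^sub>R x + b)) (a *\<^sub>R v))) (at x)"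
    if "x \<in> T" for x
  proof -
    have "f differentiable (at (a *\<^sub>R x + b))" using Suc.prems assms(2)[OF that] by simp
    then have "(f has_derivative frechet_derivative f (at (a *\<^sub>R x + b))) (at (a *\<^sub>R x + b))"
      by (simp flip: frechet_derivative_works)
    moreover have "((\<lambda>x. a *\<^sub>R x + b) has_derivative (\<lambda>v. a *\<^sub>R v)) (at x)"
      by (auto intro!: derivative_eq_intros)
    ultimately show ?thesis using diff_chain_at[of "\<lambda>x. a *\<^sub>R x + b"] by (simp add: o_def)
  qed
  have "Ck_on k (\<lambda>x. frechet_derivative (\<lambda>x. f (a *\<^sub>R x + b)) (at x) v) T" for v
  proof (rule Ck_on_cong[OF \<open>open T\<close>])
    show "Ck_on k (\<lambda>x. frechet_derivative f (at (a *\<^sub>R x + b)) (a *\<^sub>R v)) T"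
      by (rule Suc.IH) (use Suc.prems in simp)
    show "frechet_derivative f (at (a *\<^sub>R x + b)) (a *\<^sub>R v) =
        frechet_derivative (\<lambda>x. f (a *\<^sub>R x + b)) (at x) v"
      if "x \<in> T" for x
      using frechet_derivative_at[OF d[OF that]] by metis
  qed
  moreover have "\<forall>x\<in>T. (\<lambda>x. f (a *\<^sub>R x + b)) differentiable (at x)"
    using d unfolding differentiable_def by blast
  ultimately show ?case by simp
qed

section \<open>Charts as homeomorphisms of open sets\<close>

lemma is_chart_inj_on: "is_chart (U, \<phi>) \<Longrightarrow> inj_on \<phi> U"
  unfolding is_chart_def homeomorphism_def by (auto intro: inj_on_inverseI)

lemma is_chart_open_image:
  assumes "is_chart (U, \<phi>)" "open N" shows "open (\<phi> ` (U \<inter> N))"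
proof -
  obtain \<psi> where h: "homeomorphism U (\<phi> ` U) \<phi> \<psi>" and o: "open (\<phi> ` U)"
    using assms(1) by (auto simp: is_chart_def)
  have "openin (top_of_set (\<phi> ` U)) (\<phi> ` (U \<inter> N))"
    by (rule homeomorphism_imp_open_map[OF h]) (simp add: assms(2) openin_open_Int)
  then show ?thesis using o openin_open_eq by blast
qed

lemma is_chart_continuous: "is_chart (U, \<phi>) \<Longrightarrow> continuous_on U \<phi>"
  by (auto simp: is_chart_def homeomorphism_def)

lemma is_chart_inv_continuous:
  assumes "is_chart (U, \<phi>)" shows "continuous_on (\<phi> ` U) (inv_into U \<phi>)"
proof -
  obtain \<psi> where h: "homeomorphism U (\<phi> ` U) \<phi> \<psi>"
    using assms by (auto simp: is_chart_def)
  have "\<psi> y = inv_into U \<phi> y" if "y \<in> \<phi> ` U" for y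
    using h is_chart_inj_on[OF assms] that by (auto simp: homeomorphism_def)
  moreover have "continuous_on (\<phi> ` U) \<psi>"
    using h by (simp add: homeomorphism_def)
  ultimately show ?thesis by (simp cong: continuous_on_cong)
qed

lemma is_chart_open_vimage:
  "is_chart (U, \<phi>) \<Longrightarrow> open B \<Longrightarrow> open (U \<inter> \<phi> -` B)"
  by (rule continuous_open_preimage[OF is_chart_continuous]) (auto simp: is_chart_def)

text \<open>Rescaling the chart so that the ball of radius \<open>r\<close> becomes the unit ball
  gives a witness for the concentric ball of radius \<open>r / 2\<close>. The transitions of the
  rescaled chart are the old ones with an affine map before or after.\<close>

lemma small_region_chart_ball:
  fixes A :: "('m::topological_space, 'e::euclidean_space) chart set"
  assumes A: "smooth_atlas A" and U: "(U, \<phi>) \<in> A" and x: "x \<in> U"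
    and r: "0 < r" "ball (\<phi> x) r \<subseteq> \<phi> ` U"
  shows "small_region A (U \<inter> \<phi> -` ball (\<phi> x) (r / 2))"
proof -
  \<comment> \<open>The normalised chart \<open>(\<phi> - \<phi> x) / r\<close>, written as an
    affine map after \<open>\<phi>\<close>; \<open>h\<close> below undoes the normalisation in
    coordinates.\<close>
  define f where "f m = (1 / r) *\<^sub>R \<phi> m + (- (1 / r) *\<^sub>R \<phi> x)" for m
  define R' where "R' = U \<inter> \<phi> -` ball (\<phi> x) r"
  define h where "h y = r *\<^sub>R y + \<phi> x" for y
  have ch: "is_chart (U, \<phi>)" using A U by (auto simp: smooth_atlas_def)
  note inj = is_chart_inj_on[OF ch]
  have hf: "h (f m) = \<phi> m" for m using r by (simp add: h_def f_def algebra_simps)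
  have norm_f: "norm (f m) < s \<longleftrightarrow> dist (\<phi> x) (\<phi> m) < r * s" for m s
  proof -
    have "f m = (1 / r) *\<^sub>R (\<phi> m - \<phi> x)" by (simp add: f_def algebra_simps)
    then have "norm (f m) = dist (\<phi> x) (\<phi> m) / r"
      using r by (simp add: dist_norm norm_minus_commute)
    then show ?thesis using r by (simp add: pos_divide_less_eq mult.commute)
  qed
  have inv: "inv_into U \<phi> (h y) \<in> R' \<and> f (inv_into U \<phi> (h y)) = y" if "norm y < 1" for y
  proof -
    have "h y \<in> ball (\<phi> x) r" using that r by (auto simp: h_def dist_norm)
    with r have "h y \<in> \<phi> ` U" by blast
    then have "inv_into U \<phi> (h y) \<in> U" and eq: "\<phi> (inv_into U \<phi> (h y)) = h y"
      by (simp_all add: f_inv_into_f inv_into_into)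
    with \<open>h y \<in> ball (\<phi> x) r\<close> have "inv_into U \<phi> (h y) \<in> R'" by (simp add: R'_def)
    moreover have "f (inv_into U \<phi> (h y)) = y"
      using r by (simp add: f_def eq) (simp add: h_def algebra_simps)
    ultimately show ?thesis by simp
  qed
  have "open R'" using is_chart_open_vimage[OF ch] by (simp add: R'_def)
  have "R' \<subseteq> U" by (auto simp: R'_def)
  have f_ball: "f ` R' = ball 0 1"
  proof
    show "f ` R' \<subseteq> ball 0 1" using norm_f[of _ 1] by (auto simp: R'_def)
    show "ball 0 1 \<subseteq> f ` R'"
    proof
      fix y :: 'e assume "y \<in> ball 0 1"
      then have "norm y < 1" by simp
      from inv[OF this] show "y \<in> f ` R'" by (metis imageI)
    qed
  qed
  have inv_f: "inv_into U \<phi> (h (f m)) = m" if "m \<in> R'" for m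
    using that \<open>R' \<subseteq> U\<close> inj by (auto simp: hf)
  have chf: "is_chart (R', f)"
  proof -
    have "continuous_on R' f"
      unfolding f_def
      by (intro continuous_intros continuous_on_subset[OF is_chart_continuous[OF ch] \<open>R' \<subseteq> U\<close>])
    moreover have "continuous_on (ball 0 1) (\<lambda>y. inv_into U \<phi> (h y))"
    proof (rule continuous_on_compose2[OF is_chart_inv_continuous[OF ch]])
      show "continuous_on (ball 0 1) h" unfolding h_def by (intro continuous_intros)
      have "h ` ball 0 1 \<subseteq> ball (\<phi> x) r" using r by (auto simp: h_def dist_norm)
      with r show "h ` ball 0 1 \<subseteq> \<phi> ` U" by blast
    qed
    ultimately have "homeomorphism R' (ball 0 1) f (\<lambda>y. inv_into U \<phi> (h y))"
    proof (intro homeomorphismI)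
      show "(\<lambda>y. inv_into U \<phi> (h y)) ` ball 0 1 \<subseteq> R'" using inv by auto
    qed (use inv inv_f f_ball in auto)
    then show ?thesis using \<open>open R'\<close> f_ball by (auto simp: is_chart_def)
  qed
  have "smooth_transition (V, \<theta>) (R', f) \<and> smooth_transition (R', f) (V, \<theta>)"
    if V: "(V, \<theta>) \<in> A" for V \<theta>
  proof
    have chV: "is_chart (V, \<theta>)" using A V by (auto simp: smooth_atlas_def)
    then have "open V" by (simp add: is_chart_def)
    have s: "smooth_on (\<theta> ` (V \<inter> U)) (\<phi> \<circ> inv_into V \<theta>)" "smooth_on (\<phi> ` (U \<inter> V)) (\<theta> \<circ> inv_into U \<phi>)"
      using A U V unfolding smooth_atlas_def smooth_transition_def by blast+
    show "smooth_transition (V, \<theta>) (R', f)"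
      unfolding smooth_transition_def smooth_on_def prod.case
    proof
      fix k
      have "Ck_on k (\<phi> \<circ> inv_into V \<theta>) (\<theta> ` (V \<inter> R'))"
        using s(1) \<open>R' \<subseteq> U\<close> unfolding smooth_on_def by (meson Ck_on_subset Int_mono image_mono order_refl)
      from Ck_on_affine_left[OF is_chart_open_image[OF chV \<open>open R'\<close>] this]
      show "Ck_on k (f \<circ> inv_into V \<theta>) (\<theta> ` (V \<inter> R'))" by (simp only: f_def o_def)
    qed
    show "smooth_transition (R', f) (V, \<theta>)"
      unfolding smooth_transition_def smooth_on_def prod.case
    proof
      fix k
      have op: "open (f ` (R' \<inter> V))" by (rule is_chart_open_image[OF chf \<open>open V\<close>])
      show "Ck_on k (\<theta> \<circ> inv_into R' f) (f ` (R' \<inter> V))"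
      proof (rule Ck_on_cong[OF op])
        \<comment> \<open>The inverse of \<open>f\<close> is the inverse of \<open>\<phi>\<close>
          after \<open>h\<close>, so this transition is an old one precomposed with an affine
          map.\<close>
        show "Ck_on k (\<lambda>y. (\<theta> \<circ> inv_into U \<phi>) (r *\<^sub>R y + \<phi> x)) (f ` (R' \<inter> V))"
          by (rule Ck_on_affine_right[OF op, of _ _ "\<phi> ` (U \<inter> V)"])
            (use s(2) hf \<open>R' \<subseteq> U\<close> in \<open>auto simp: smooth_on_def h_def simp del: o_apply\<close>)
        show "(\<theta> \<circ> inv_into U \<phi>) (r *\<^sub>R y + \<phi> x) = (\<theta> \<circ> inv_into R' f) y" if "y \<in> f ` (R' \<inter> V)" for y
          using that inv_f is_chart_inj_on[OF chf] by (auto simp flip: h_def)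
      qed
    qed
  qed
  with chf f_ball have "diffeo_onto A R' f (ball 0 1)" by (auto simp: diffeo_onto_def)
  moreover have "U \<inter> \<phi> -` ball (\<phi> x) (r / 2) \<subseteq> R'" using r by (auto simp: R'_def)
  moreover have "f ` (U \<inter> \<phi> -` ball (\<phi> x) (r / 2)) = ball 0 (1 / 2)"
  proof
    show "f ` (U \<inter> \<phi> -` ball (\<phi> x) (r / 2)) \<subseteq> ball 0 (1 / 2)" using norm_f[of _ "1/2"] by auto
    show "ball 0 (1 / 2) \<subseteq> f ` (U \<inter> \<phi> -` ball (\<phi> x) (r / 2))"
    proof
      fix y :: 'e assume y: "y \<in> ball 0 (1 / 2)"
      then have "norm y < 1" by simp
      from inv[OF this] have "inv_into U \<phi> (h y) \<in> U" "f (inv_into U \<phi> (h y)) = y"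
        using \<open>R' \<subseteq> U\<close> by auto
      with norm_f[of "inv_into U \<phi> (h y)" "1/2"] y
      have "inv_into U \<phi> (h y) \<in> U \<inter> \<phi> -` ball (\<phi> x) (r / 2)" by simp
      then show "y \<in> f ` (U \<inter> \<phi> -` ball (\<phi> x) (r / 2))"
        using \<open>f (inv_into U \<phi> (h y)) = y\<close> by (metis imageI)
    qed
  qed
  ultimately show ?thesis
    using is_chart_open_vimage[OF ch] unfolding small_region_def by blast
qed

text \<open>The image of \<open>U \<inter> N\<close> is open because a chart is a homeomorphism, so
  it contains a ball about \<open>\<phi> x\<close>; injectivity of the chart keeps the region cut
  out by the half ball inside \<open>N\<close>.\<close>

lemma small_region_basis:
  assumes A: "smooth_atlas A" and N: "open N" "x \<in> N"
  obtains R where "small_region A R" "x \<in> R" "R \<subseteq> N"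
proof -
  obtain U \<phi> where U: "(U, \<phi>) \<in> A" "x \<in> U"
    using A unfolding smooth_atlas_def by (metis UNIV_I UN_E prod.collapse)
  have ch: "is_chart (U, \<phi>)" using A U by (auto simp: smooth_atlas_def)
  have "open (\<phi> ` (U \<inter> N))" by (rule is_chart_open_image[OF ch N(1)])
  then obtain r where r: "r > 0" "ball (\<phi> x) r \<subseteq> \<phi> ` (U \<inter> N)"
    using U N by (meson IntI image_eqI openE)
  have "U \<inter> \<phi> -` ball (\<phi> x) (r / 2) \<subseteq> N"
  proof
    fix m assume m: "m \<in> U \<inter> \<phi> -` ball (\<phi> x) (r / 2)"
    then have "\<phi> m \<in> \<phi> ` (U \<inter> N)" using r by auto
    with m is_chart_inj_on[OF ch] show "m \<in> N" by (auto dest: inj_onD)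
  qed
  moreover have "small_region A (U \<inter> \<phi> -` ball (\<phi> x) (r / 2))"
    using r by (intro small_region_chart_ball[OF A U]) auto
  ultimately show thesis using that U r by auto
qed


subsection \<open>Horizontal lifts for a flat cocycle\<close>

lemma steps_mono:
  fixes t :: "nat \<Rightarrow> real"
  assumes "\<And>i. i < n \<Longrightarrow> t i < t (Suc i)" and "i \<le> j" "j \<le> n"
  shows "t i \<le> t j"
  using assms(2,3)
proof (induction j rule: dec_induct)
  case (step k)
  then show ?case using assms(1)[of k] by simp
qed simp

text \<open>The holonomy argument is purely topological and algebraic: it rests on a basis of small
  sets and on bijections of a bare type obeying the cocycle law and restricting along
  inclusions.\<close>

locale flat_cocycle =
  fixes small :: "'m::topological_space set \<Rightarrow> bool"
    and w :: "'m set \<Rightarrow> 'm \<Rightarrow> 'm \<Rightarrow> 'k \<Rightarrow> 'k"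
  assumes small_open: "small R \<Longrightarrow> open R"
    and small_basis: "open N \<Longrightarrow> x \<in> N \<Longrightarrow> \<exists>R. small R \<and> x \<in> R \<and> R \<subseteq> N"
    and w_bij: "small R \<Longrightarrow> x \<in> R \<Longrightarrow> y \<in> R \<Longrightarrow> bij (w R y x)"
    and w_comp: "small R \<Longrightarrow> x \<in> R \<Longrightarrow> y \<in> R \<Longrightarrow> z \<in> R \<Longrightarrow> w R y x \<circ> w R x z = w R y z"
    and w_subset: "small R \<Longrightarrow> small R' \<Longrightarrow> R \<subseteq> R' \<Longrightarrow> x \<in> R \<Longrightarrow> y \<in> R \<Longrightarrow> w R y x = w R' y x"
begin

text \<open>An injective idempotent map is the identity.\<close>

lemma w_refl: "small R \<Longrightarrow> x \<in> R \<Longrightarrow> w R x x = id"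
proof -
  assume R: "small R" "x \<in> R"
  have "w R x x \<circ> w R x x = w R x x" by (rule w_comp) (use R in auto)
  then have "w R x x (w R x x v) = w R x x v" for v by (simp add: fun_eq_iff)
  then show "w R x x = id"
    using w_bij[OF R(1,2,2)] by (auto simp: fun_eq_iff dest: bij_is_inj injD)
qed

text \<open>The lift \<open>u\<close> is the covariantly constant section over \<open>f\<close>. Allowing any parameter
  space \<open>S\<close> lets lifts over paths and over homotopies be treated alike.\<close>

definition horizontal :: "'s::topological_space set \<Rightarrow> ('s \<Rightarrow> 'm) \<Rightarrow> ('s \<Rightarrow> 'k \<Rightarrow> 'k) \<Rightarrow> bool" where
  "horizontal S f u \<longleftrightarrow>
     (\<forall>s\<in>S. \<forall>R. small R \<longrightarrow> f s \<in> R \<longrightarrow> (\<forall>\<^sub>F r in at s within S. u r = w R (f r) (f s) \<circ> u s))"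

lemma eventually_in_small:
  assumes "continuous_on S f" "s \<in> S" "small R" "f s \<in> R"
  shows "\<forall>\<^sub>F r in at s within S. f r \<in> R"
proof -
  have "(f \<longlongrightarrow> f s) (at s within S)" using assms by (simp add: continuous_on_def)
  then show ?thesis by (rule topological_tendstoD) (use small_open assms(3,4) in auto)
qed

text \<open>The truth value of \<open>u s = v s\<close> is locally constant: near \<open>s\<close>
  both lifts arise from their values at \<open>s\<close> by the same injective map.\<close>

lemma horizontal_unique:
  assumes S: "connected S" and f: "continuous_on S f"
    and u: "horizontal S f u" and v: "horizontal S f v" and a: "a \<in> S" "u a = v a" and b: "b \<in> S"
  shows "u b = v b"
proof -
  have "(u a = v a) = (u b = v b)"
  proof (rule connected_local_const[OF S a(1) b], rule ballI)
    fix s assume s: "s \<in> S"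
    obtain R where R: "small R" "f s \<in> R" using small_basis[of UNIV "f s"] by auto
    have "\<forall>\<^sub>F r in at s within S. u r = w R (f r) (f s) \<circ> u s"
      "\<forall>\<^sub>F r in at s within S. v r = w R (f r) (f s) \<circ> v s"
      using u v s R by (auto simp: horizontal_def)
    moreover have "\<forall>\<^sub>F r in at s within S. f r \<in> R"
      using eventually_in_small[OF f s R] .
    ultimately show "\<forall>\<^sub>F r in at s within S. (u s = v s) = (u r = v r)"
    proof eventually_elim
      case (elim r)
      then have "inj (w R (f r) (f s))" using w_bij R bij_is_inj by blast
      with elim show ?case by (auto simp: fun_eq_iff dest: injD)
    qed
  qed
  with a show ?thesis by simp
qed

text \<open>The test region \<open>R'\<close> need not be nested with \<open>R\<close>, so the two
  are compared through a small \<open>Q\<close> around \<open>f s\<close> inside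
  \<open>R \<inter> R'\<close>. The agreement obtained is only local, which is all that
  \<open>horizontal\<close> asks.\<close>

lemma horizontal_in_small:
  assumes f: "continuous_on S f" and R: "small R" "f ` S \<subseteq> R" and a: "f a \<in> R"
  shows "horizontal S f (\<lambda>s. w R (f s) (f a))"
  unfolding horizontal_def
proof (intro ballI allI impI)
  fix s R' assume s: "s \<in> S" and R': "small R'" "f s \<in> R'"
  have fs: "f s \<in> R" using s R by auto
  have "open (R \<inter> R')" using R R' small_open by blast
  then obtain Q where Q: "small Q" "f s \<in> Q" "Q \<subseteq> R \<inter> R'"
    using small_basis[of "R \<inter> R'" "f s"] fs R' by blast
  have "\<forall>\<^sub>F r in at s within S. f r \<in> Q" using eventually_in_small[OF f s Q(1,2)] .
  then show "\<forall>\<^sub>F r in at s within S. w R (f r) (f a) = w R' (f r) (f s) \<circ> w R (f s) (f a)"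
  proof eventually_elim
    case (elim r)
    have "w R (f r) (f a) = w R (f r) (f s) \<circ> w R (f s) (f a)"
      by (rule w_comp[symmetric]) (use elim Q R fs a in auto)
    also have "w R (f r) (f s) = w Q (f r) (f s)"
      by (rule w_subset[symmetric]) (use elim Q R in auto)
    also have "\<dots> = w R' (f r) (f s)"
      by (rule w_subset) (use elim Q R' in auto)
    finally show ?case .
  qed
qed

lemma horizontal_compose:
  assumes u: "horizontal S f u" and \<phi>: "continuous_on T \<phi>" "\<phi> ` T \<subseteq> S"
  shows "horizontal T (f \<circ> \<phi>) (u \<circ> \<phi>)"
  unfolding horizontal_def
proof (intro ballI allI impI)
  fix s R assume s: "s \<in> T" and R: "small R" "(f \<circ> \<phi>) s \<in> R"
  define P where "P r \<longleftrightarrow> u r = w R (f r) (f (\<phi> s)) \<circ> u (\<phi> s)" for r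
  have "\<forall>\<^sub>F r in at (\<phi> s) within S. P r"
    using u R s \<phi> by (auto simp: horizontal_def P_def)
  then obtain N where N: "open N" "\<phi> s \<in> N" "\<And>r. r \<in> N \<Longrightarrow> r \<in> S \<Longrightarrow> r \<noteq> \<phi> s \<Longrightarrow> P r"
    unfolding eventually_at_topological by blast
  \<comment> \<open>The filter at \<open>\<phi> s\<close> omits that point, but
    \<open>\<phi> r\<close> may equal \<open>\<phi> s\<close> for \<open>r \<noteq> s\<close>;
    \<open>w_refl\<close> supplies this case.\<close>
  have "P (\<phi> s)" using R w_refl by (simp add: P_def)
  then have P: "P r" if "r \<in> N" "r \<in> S" for r using N that by metis
  have "(\<phi> \<longlongrightarrow> \<phi> s) (at s within T)" using \<phi>(1) s by (simp add: continuous_on_def)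
  then have "\<forall>\<^sub>F r in at s within T. \<phi> r \<in> N" by (rule topological_tendstoD) (use N in auto)
  moreover have "\<forall>\<^sub>F r in at s within T. r \<in> T"
    by (simp add: eventually_at_filter)
  ultimately show "\<forall>\<^sub>F r in at s within T. (u \<circ> \<phi>) r = w R ((f \<circ> \<phi>) r) ((f \<circ> \<phi>) s) \<circ> (u \<circ> \<phi>) s"
  proof eventually_elim
    case (elim r)
    with P[of "\<phi> r"] \<phi>(2) show ?case by (auto simp: P_def)
  qed
qed

text \<open>A point outside a closed set has a neighbourhood missing it, so the condition along that
  half is vacuous there; elsewhere the hypotheses apply, and the filter within a union is the
  supremum of the two filters.\<close>

lemma horizontal_glue:
  assumes C: "closed C" "horizontal (S \<inter> C) f u" and D: "closed D" "horizontal (S \<inter> D) f u"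
    and S: "S \<subseteq> C \<union> D"
  shows "horizontal S f u"
  unfolding horizontal_def
proof (intro ballI allI impI)
  fix s R assume s: "s \<in> S" and R: "small R" "f s \<in> R"
  define P where "P r \<longleftrightarrow> u r = w R (f r) (f s) \<circ> u s" for r
  have 1: "\<forall>\<^sub>F r in at s within (S \<inter> E). P r" if "closed E" "horizontal (S \<inter> E) f u" for E
  proof (cases "s \<in> E")
    case True
    then show ?thesis using that R s by (auto simp: horizontal_def P_def)
  next
    case False
    then have "open (- E)" "s \<in> - E" using that by auto
    then show ?thesis unfolding eventually_at_topological by (intro exI[of _ "- E"]) auto
  qed
  have "S = (S \<inter> C) \<union> (S \<inter> D)" using S by auto
  then have "at s within S = sup (at s within (S \<inter> C)) (at s within (S \<inter> D))"
    by (metis at_within_union)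
  then show "\<forall>\<^sub>F r in at s within S. P r"
    using 1[OF C] 1[OF D] by (simp add: eventually_sup)
qed

text \<open>The defining equation multiplies on the left, so multiplication on the right by a fixed
  \<open>c\<close> is free; this is how a lift gets another initial value.\<close>

lemma horizontal_right: "horizontal S f u \<Longrightarrow> horizontal S f (\<lambda>s. u s \<circ> c)"
  unfolding horizontal_def
proof (intro ballI allI impI)
  fix s R
  assume "\<forall>s\<in>S. \<forall>R. small R \<longrightarrow> f s \<in> R \<longrightarrow> (\<forall>\<^sub>F r in at s within S. u r = w R (f r) (f s) \<circ> u s)"
    and "s \<in> S" "small R" "f s \<in> R"
  then have "\<forall>\<^sub>F r in at s within S. u r = w R (f r) (f s) \<circ> u s" by blast
  then show "\<forall>\<^sub>F r in at s within S. u r \<circ> c = w R (f r) (f s) \<circ> (u s \<circ> c)"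
    by eventually_elim (simp add: comp_assoc)
qed

lemma horizontal_cong:
  assumes "\<And>s. s \<in> S \<Longrightarrow> f s = g s" "\<And>s. s \<in> S \<Longrightarrow> u s = v s"
  shows "horizontal S f u = horizontal S g v"
proof -
  have "(\<forall>\<^sub>F r in at s within S. u r = w R (f r) (f s) \<circ> u s) =
      (\<forall>\<^sub>F r in at s within S. v r = w R (g r) (g s) \<circ> v s)" if "s \<in> S" for s R
    using assms that by (auto simp: eventually_at_topological)
  then show ?thesis using assms by (simp add: horizontal_def)
qed

lemma horizontal_subset: "horizontal S f u \<Longrightarrow> T \<subseteq> S \<Longrightarrow> horizontal T f u"
  unfolding horizontal_def
  by (meson filter_leD at_le subsetD)

text \<open>Over a constant map every constant is a lift, since \<open>w R x x = id\<close>; by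
  uniqueness \<open>u\<close> is one of them. Meant for the fixed ends of a homotopy.\<close>

lemma horizontal_const_unique:
  assumes S: "connected S" "a \<in> S" "b \<in> S" and u: "horizontal S f u" and f: "\<And>s. s \<in> S \<Longrightarrow> f s = x"
  shows "u a = u b"
proof -
  obtain R where R: "small R" "x \<in> R" using small_basis[of UNIV x] by auto
  have "horizontal S (\<lambda>s. x) (\<lambda>s. w R x x)"
    by (rule horizontal_in_small) (use R in auto)
  from horizontal_right[OF this, of "u a"] have 1: "horizontal S (\<lambda>s. x) (\<lambda>s. u a)"
    using w_refl[OF R] by simp
  have 2: "horizontal S (\<lambda>s. x) u"
    using u by (subst horizontal_cong[of _ _ f _ u]) (simp_all add: f)
  show ?thesis
    using horizontal_unique[OF S(1) _ 1 2 S(2) _ S(3)] by simp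
qed

text \<open>Each induction step extends the lift across one further strip lying over a single small
  set. A one-point \<open>I\<close> gives the case of a path, an interval that of a homotopy; the
  product is read off along the line over \<open>p\<close> only.\<close>

lemma horizontal_strip:
  fixes f :: "'p::topological_space \<times> real \<Rightarrow> 'm"
  assumes I: "connected I" "p \<in> I" and t: "\<And>i. i < n \<Longrightarrow> t i < t (Suc i)"
    and f: "continuous_on (I \<times> {t 0..t n}) f" and f0: "\<And>q. q \<in> I \<Longrightarrow> f (q, t 0) = x"
    and R: "\<And>i. i < n \<Longrightarrow> small (R i) \<and> f ` (I \<times> {t i..t (Suc i)}) \<subseteq> R i"
  shows "\<exists>u. horizontal (I \<times> {t 0..t n}) f u \<and> u (p, t 0) = id \<and>
    u (p, t n) = path_product w (\<lambda>s. f (p, s)) t R n"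
  using t f R
proof (induction n)
  case 0
  \<comment> \<open>The bottom edge is sent to the single point \<open>x\<close>, so the constant
    \<open>id\<close> is a lift over it.\<close>
  obtain Q where Q: "small Q" "x \<in> Q" using small_basis[of UNIV x] by auto
  have "horizontal (I \<times> {t 0..t 0}) (\<lambda>_. x) (\<lambda>_. w Q x x)"
    by (rule horizontal_in_small) (use Q in auto)
  moreover have "f z = x" if "z \<in> I \<times> {t 0..t 0}" for z using that f0 by (cases z) auto
  ultimately have "horizontal (I \<times> {t 0..t 0}) f (\<lambda>_. id)"
    using w_refl[OF Q] by (subst horizontal_cong[of _ _ "\<lambda>_. x" _ "\<lambda>_. id"]) simp_all
  then show ?case by (intro exI conjI) (assumption, simp_all)
next
  case (Suc n)
  have le: "t 0 \<le> t n"
    using steps_mono[of "Suc n" t 0 n] Suc.prems(1) by simp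
  have lt: "t n < t (Suc n)" using Suc.prems(1) by simp
  have f1: "continuous_on (I \<times> {t 0..t n}) f"
    by (rule continuous_on_subset[OF Suc.prems(2)]) (use lt in auto)
  have f2: "continuous_on (I \<times> {t n..t (Suc n)}) f"
    by (rule continuous_on_subset[OF Suc.prems(2)]) (use le in auto)
  have "\<exists>u. horizontal (I \<times> {t 0..t n}) f u \<and> u (p, t 0) = id \<and>
      u (p, t n) = path_product w (\<lambda>s. f (p, s)) t R n"
    by (rule Suc.IH[OF _ f1]) (use Suc.prems(1,3) in simp_all)
  then obtain u where u: "horizontal (I \<times> {t 0..t n}) f u" "u (p, t 0) = id"
    "u (p, t n) = path_product w (\<lambda>s. f (p, s)) t R n"
    by (elim exE conjE)
  \<comment> \<open>The lift over the new strip, normalised to agree with \<open>u\<close> at the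
    point \<open>(p, t n)\<close>.\<close>
  define v where "v z = w (R n) (f z) (f (p, t n)) \<circ> u (p, t n)" for z
  have R: "small (R n)" "f ` (I \<times> {t n..t (Suc n)}) \<subseteq> R n" using Suc.prems(3)[of n] by auto
  have fp: "f (p, t n) \<in> R n" using R I lt by auto
  have v: "horizontal (I \<times> {t n..t (Suc n)}) f v"
    unfolding v_def by (intro horizontal_right horizontal_in_small f2 R fp)
  \<comment> \<open>Agreement at \<open>(p, t n)\<close> spreads along the connected edge
    \<open>I \<times> {t n}\<close>, so the two lifts can be glued.\<close>
  have uv: "u (q, t n) = v (q, t n)" if "q \<in> I" for q
  proof (rule horizontal_unique[of "I \<times> {t n}" f u v "(p, t n)"])
    show "continuous_on (I \<times> {t n}) f" by (rule continuous_on_subset[OF f1]) (use le in auto)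
    show "horizontal (I \<times> {t n}) f u" by (rule horizontal_subset[OF u(1)]) (use le in auto)
    show "horizontal (I \<times> {t n}) f v" by (rule horizontal_subset[OF v]) (use lt in auto)
    show "u (p, t n) = v (p, t n)" by (simp add: v_def w_refl[OF R(1) fp])
  qed (use I that in \<open>auto intro: connected_Times\<close>)
  define u' where "u' z = (if snd z \<le> t n then u z else v z)" for z
  have "horizontal (I \<times> {t 0..t (Suc n)}) f u'"
  proof (rule horizontal_glue[where C = "{z. snd z \<le> t n}" and D = "{z. t n \<le> snd z}"])
    have "I \<times> {t 0..t (Suc n)} \<inter> {z. snd z \<le> t n} = I \<times> {t 0..t n}" using lt by auto
    with u(1) show "horizontal (I \<times> {t 0..t (Suc n)} \<inter> {z. snd z \<le> t n}) f u'"
      by (subst horizontal_cong[of _ f f u' u]) (auto simp: u'_def)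
    have "I \<times> {t 0..t (Suc n)} \<inter> {z. t n \<le> snd z} = I \<times> {t n..t (Suc n)}" using le by auto
    with v show "horizontal (I \<times> {t 0..t (Suc n)} \<inter> {z. t n \<le> snd z}) f u'"
      by (subst horizontal_cong[of _ f f u' v]) (auto simp: u'_def uv)
  qed (auto intro!: closed_Collect_le continuous_intros)
  moreover have "u' (p, t 0) = id" using u le by (simp add: u'_def)
  moreover have "u' (p, t (Suc n)) = path_product w (\<lambda>s. f (p, s)) t R (Suc n)"
    using lt u(3) by (simp add: u'_def v_def)
  ultimately show ?case by blast
qed


subsection \<open>Parallel transport and homotopy invariance\<close>

definition subdivides :: "(real \<Rightarrow> 'm) \<Rightarrow> nat \<Rightarrow> (nat \<Rightarrow> real) \<Rightarrow> (nat \<Rightarrow> 'm set) \<Rightarrow> bool" where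
  "subdivides g n t R \<longleftrightarrow>
     unit_partition n t \<and> (\<forall>i<n. small (R i) \<and> g ` {t i..t (Suc i)} \<subseteq> R i)"

text \<open>The lift is chosen, but uniqueness determines its value at 1. As no partition occurs
  here, partitions never have to be compared by common refinement.\<close>

definition holonomy :: "(real \<Rightarrow> 'm) \<Rightarrow> 'k \<Rightarrow> 'k" where
  "holonomy g = (SOME u. horizontal {0..1} g u \<and> u 0 = id) 1"

lemma holonomy_eq:
  assumes "path g" "horizontal {0..1} g u" "u 0 = id"
  shows "holonomy g = u 1"
proof -
  define v where "v = (SOME u. horizontal {0..1} g u \<and> u 0 = id)"
  have "\<exists>u. horizontal {0..1} g u \<and> u 0 = id"
    by (intro exI conjI) (rule assms(2,3))+
  note v = someI_ex[OF this, folded v_def, THEN conjunct1] someI_ex[OF this, folded v_def, THEN conjunct2]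
  have "v 1 = u 1"
    by (rule horizontal_unique[OF connected_Icc assms(1)[unfolded path_def] v(1) assms(2), of 0 1])
      (simp_all add: v(2) assms(3))
  then show ?thesis by (simp add: holonomy_def v_def)
qed

text \<open>A path is treated as a strip over the one-point parameter set
  \<open>{0}\<close>.\<close>

lemma subdivides_horizontal:
  assumes g: "path g" and d: "subdivides g n t R"
  obtains u where "horizontal {0..1} g u" "u 0 = id" "u 1 = path_product w g t R n"
proof -
  have t: "t 0 = 0" "t n = 1" "\<And>i. i < n \<Longrightarrow> t i < t (Suc i)"
    using d by (auto simp: subdivides_def unit_partition_def)
  have "\<exists>u. horizontal ({0::real} \<times> {t 0..t n}) (g \<circ> snd) u \<and> u (0, t 0) = id \<and>
      u (0, t n) = path_product w (\<lambda>s. (g \<circ> snd) (0::real, s)) t R n"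
  proof (rule horizontal_strip)
    show "continuous_on ({0} \<times> {t 0..t n}) (g \<circ> snd)"
      using g t by (intro continuous_on_compose continuous_intros) (simp add: path_def)
  qed (use d t in \<open>auto simp: subdivides_def image_subset_iff\<close>)
  then obtain u where u: "horizontal ({0::real} \<times> {0..1}) (g \<circ> snd) u" "u (0, 0) = id"
    "u (0, 1) = path_product w g t R n"
    using t by auto
  have "horizontal {0..1} ((g \<circ> snd) \<circ> Pair (0::real)) (u \<circ> Pair 0)"
    by (rule horizontal_compose[OF u(1)]) (auto intro!: continuous_intros)
  then have "horizontal {0..1} g (u \<circ> Pair 0)" by (simp add: comp_def)
  then show thesis by (rule that) (use u in simp_all)
qed

text \<open>The left-hand side knows nothing of \<open>n\<close>, \<open>t\<close> and
  \<open>R\<close>: this is the independence of the subdivision.\<close>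

lemma holonomy_path_product: "path g \<Longrightarrow> subdivides g n t R \<Longrightarrow> holonomy g = path_product w g t R n"
proof -
  assume g: "path g" and d: "subdivides g n t R"
  obtain u where "horizontal {0..1} g u" "u 0 = id" "u 1 = path_product w g t R n"
    using subdivides_horizontal[OF g d] .
  with holonomy_eq[OF g] show ?thesis by simp
qed

text \<open>A Lebesgue number for the cover of the unit interval by preimages of small sets bounds
  the mesh.\<close>

lemma subdivides_exists:
  assumes g: "path g"
  obtains n t R where "subdivides g n t R"
proof -
  \<comment> \<open>Clamping the parameter makes \<open>g'\<close> continuous on the whole line, so
    that preimages of small sets are open in the reals.\<close>
  define g' where "g' = g \<circ> (\<lambda>s. max 0 (min 1 s))"
  have g': "continuous_on UNIV g'"
  proof -
    have 1: "continuous_on UNIV (\<lambda>s::real. max 0 (min 1 s))" by (intro continuous_intros)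
    have 2: "(\<lambda>s::real. max 0 (min 1 s)) ` UNIV \<subseteq> {0..1}" by auto
    show ?thesis
      unfolding g'_def by (rule continuous_on_compose[OF 1 continuous_on_subset[OF g[unfolded path_def] 2]])
  qed
  define G where "G = {g' -` R | R. small R}"
  have G_open: "open X" if "X \<in> G" for X
    using that g' small_open by (auto simp: G_def continuous_on_open_vimage[OF open_UNIV])
  have G_cover: "{0..1} \<subseteq> \<Union>G"
  proof
    fix s :: real
    obtain R where "small R" "g' s \<in> R" using small_basis[of UNIV "g' s"] by auto
    then show "s \<in> \<Union>G" by (auto simp: G_def)
  qed
  obtain e where e: "0 < e" "\<And>s. s \<in> {0..1} \<Longrightarrow> \<exists>X\<in>G. ball s e \<subseteq> X"
    using Heine_Borel_lemma[OF compact_Icc G_cover G_open] by blast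
  then have "\<forall>s\<in>{0..1}. \<exists>R. small R \<and> g' ` ball s e \<subseteq> R" unfolding G_def by blast
  then obtain R where R: "\<And>s. s \<in> {0..1} \<Longrightarrow> small (R s) \<and> g' ` ball s e \<subseteq> R s" by metis
  obtain n where n: "n > 0" "1 / real n < e"
    using e(1) by (metis nat_approx_posE of_nat_Suc zero_less_Suc)
  define t where "t i = real i / real n" for i
  \<comment> \<open>A piece has length \<open>1 / real n\<close>, less than \<open>e\<close>, so it
    lies in the ball about its left end \<open>t i\<close>.\<close>
  have "subdivides g n t (\<lambda>i. R (t i))"
    unfolding subdivides_def
  proof (intro conjI allI impI)
    show "unit_partition n t" using n by (auto simp: unit_partition_def t_def divide_strict_right_mono)
    fix i assume i: "i < n"
    then have ti: "t i \<in> {0..1}" by (simp add: t_def)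
    with R show "small (R (t i))" by blast
    have "t (Suc i) \<le> 1" using i by (simp add: t_def)
    have "g s \<in> R (t i)" if "s \<in> {t i..t (Suc i)}" for s
    proof -
      have "t (Suc i) = t i + 1 / real n" by (simp add: t_def add_divide_distrib)
      with that n have "s \<in> ball (t i) e" by (auto simp: dist_real_def)
      moreover have "g' s = g s" using that ti \<open>t (Suc i) \<le> 1\<close> by (simp add: g'_def)
      ultimately show ?thesis using R[OF ti] by (metis image_subset_iff)
    qed
    then show "g ` {t i..t (Suc i)} \<subseteq> R (t i)" by auto
  qed
  then show thesis by (rule that)
qed

lemma holonomy_horizontal:
  assumes "path g"
  obtains u where "horizontal {0..1} g u" "u 0 = id" "u 1 = holonomy g"
proof -
  obtain n t R where "subdivides g n t R" using subdivides_exists[OF assms] .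
  then obtain u where u: "horizontal {0..1} g u" "u 0 = id"
    using subdivides_horizontal[OF assms] by blast
  with holonomy_eq[OF assms] show thesis by (intro that[of u]) auto
qed

text \<open>The lift over \<open>g\<close> is started at \<open>v 1\<close> by multiplying it on the
  right, hence the operator of the later path stands on the left.\<close>

lemma holonomy_join:
  assumes g: "path g" and h: "path h" and gh: "pathfinish h = pathstart g"
  shows "holonomy (h +++ g) = holonomy g \<circ> holonomy h"
proof -
  obtain u where u: "horizontal {0..1} g u" "u 0 = id" "u 1 = holonomy g"
    using holonomy_horizontal[OF g] .
  obtain v where v: "horizontal {0..1} h v" "v 0 = id" "v 1 = holonomy h"
    using holonomy_horizontal[OF h] .
  define r where "r s = (if s \<le> 1 / 2 then v (2 * s) else u (2 * s - 1) \<circ> v 1)" for s :: real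
  have "horizontal {0..1} (h +++ g) r"
  proof (rule horizontal_glue[where C = "{..1/2}" and D = "{1/2..}"])
    have "horizontal ({0..1} \<inter> {..1/2}) (h \<circ> (\<lambda>s. 2 * s)) (v \<circ> (\<lambda>s. 2 * s))"
      by (rule horizontal_compose[OF v(1)]) (auto intro!: continuous_intros)
    then show "horizontal ({0..1} \<inter> {..1/2}) (h +++ g) r"
      by (rule horizontal_cong[THEN iffD1, rotated 2]) (auto simp: joinpaths_def r_def)
    have "horizontal ({0..1} \<inter> {1/2..}) (g \<circ> (\<lambda>s. 2 * s - 1)) (u \<circ> (\<lambda>s. 2 * s - 1))"
      by (rule horizontal_compose[OF u(1)]) (auto intro!: continuous_intros)
    note right = horizontal_right[OF this, of "v 1"]
    have on_right: "(g \<circ> (\<lambda>s. 2 * s - 1)) s = (h +++ g) s \<and> (u \<circ> (\<lambda>s. 2 * s - 1)) s \<circ> v 1 = r s"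
      if "1 / 2 \<le> s" for s
    \<comment> \<open>At the junction \<open>r\<close> and \<open>+++\<close> both take their first
      branch; it matches the second because \<open>u 0 = id\<close> and \<open>h\<close> ends where
      \<open>g\<close> starts.\<close>
    proof (cases "s = 1 / 2")
      case True
      show ?thesis
        unfolding True using gh u(2) by (simp add: joinpaths_def r_def pathfinish_def pathstart_def)
    next
      case False
      with that have "\<not> s \<le> 1 / 2" by simp
      then show ?thesis by (simp only: joinpaths_def r_def o_apply if_False simp_thms)
    qed
    show "horizontal ({0..1} \<inter> {1/2..}) (h +++ g) r"
      by (rule horizontal_cong[THEN iffD1, OF _ _ right]) (use on_right in auto)
  qed auto
  moreover have "r 0 = id" "r 1 = holonomy g \<circ> holonomy h" using u v by (simp_all add: r_def)
  ultimately show ?thesis using holonomy_eq[of "h +++ g" r] g h gh by simp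
qed

text \<open>By the tube lemma a subdivision for the intermediate path at \<open>a\<close> serves all
  parameters \<open>b\<close> near \<open>a\<close>. A single lift over the resulting strip
  restricts to lifts over all these paths.\<close>

lemma holonomy_homotopic:
  assumes "homotopic_paths UNIV g h"
  shows "holonomy g = holonomy h"
proof -
  obtain k where k: "continuous_on ({0..1::real} \<times> {0..1::real}) k"
    and k01: "\<forall>s\<in>{0..1}. k (0, s) = g s" "\<forall>s\<in>{0..1}. k (1, s) = h s"
    and ends: "\<forall>a\<in>{0..1}. pathstart (k \<circ> Pair a) = pathstart g \<and> pathfinish (k \<circ> Pair a) = pathfinish g"
    using assms unfolding homotopic_paths by auto
  have path_k: "path (k \<circ> Pair a)" if "a \<in> {0..1}" for a
    unfolding path_def using that
    by (intro continuous_on_compose continuous_on_subset[OF k] continuous_intros) auto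
  have k_ends: "holonomy (k \<circ> Pair 0) = holonomy (k \<circ> Pair 1)"
  proof (rule connected_local_const[of "{0..1}"], simp, simp, simp, rule ballI)
    fix a :: real assume a: "a \<in> {0..1}"
    obtain n t R where d: "subdivides (k \<circ> Pair a) n t R"
      using subdivides_exists[OF path_k[OF a]] .
    have t: "t 0 = 0" "t n = 1" "\<And>i. i < n \<Longrightarrow> t i < t (Suc i)"
      using d by (auto simp: subdivides_def unit_partition_def)
    note mono = steps_mono[of n t, OF t(3)]
    have "\<exists>e>0. \<forall>b\<in>{0..1} \<inter> ball a e. \<forall>s\<in>{t i..t (Suc i)}. k (b, s) \<in> R i" if i: "i < n" for i
    proof -
      have ti: "{t i..t (Suc i)} \<subseteq> {0..1}" using mono[of 0 i] mono[of "Suc i" n] i t by auto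
      have "open (R i)" and Ri: "(k \<circ> Pair a) ` {t i..t (Suc i)} \<subseteq> R i"
        using d i small_open by (auto simp: subdivides_def)
      then obtain W where W: "open W" "W \<inter> ({0..1} \<times> {0..1}) = k -` R i \<inter> ({0..1} \<times> {0..1})"
        using k unfolding continuous_on_open_invariant by meson
      have "{a} \<times> {t i..t (Suc i)} \<subseteq> W"
      proof clarify
        fix s assume s: "s \<in> {t i..t (Suc i)}"
        have "k (a, s) \<in> R i" using Ri s by auto
        moreover have "s \<in> {0..1}" using s ti by blast
        ultimately have "(a, s) \<in> W \<inter> ({0..1} \<times> {0..1})" unfolding W(2) using a by simp
        then show "(a, s) \<in> W" by blast
      qed
      from Elementary_Topology.tube_lemma[OF compact_Icc W(1) this]
      obtain X where X: "a \<in> X" "open X" "X \<times> {t i..t (Suc i)} \<subseteq> W" by blast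
      then obtain e where e: "e > 0" "ball a e \<subseteq> X" by (meson openE)
      have "k (b, s) \<in> R i" if "b \<in> {0..1} \<inter> ball a e" "s \<in> {t i..t (Suc i)}" for b s
      proof -
        have "(b, s) \<in> W \<inter> ({0..1} \<times> {0..1})" using that ti X e by blast
        then show ?thesis unfolding W(2) by simp
      qed
      with e show ?thesis by blast
    qed
    then obtain e where e: "\<And>i. i < n \<Longrightarrow> e i > 0"
      "\<And>i b s. i < n \<Longrightarrow> b \<in> {0..1} \<inter> ball a (e i) \<Longrightarrow> s \<in> {t i..t (Suc i)} \<Longrightarrow> k (b, s) \<in> R i"
      by metis
    \<comment> \<open>The inserted 1 keeps the set nonempty for \<open>Min\<close>.\<close>
    define \<epsilon> where "\<epsilon> = Min (insert 1 (e ` {..<n}))"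
    have \<epsilon>: "\<epsilon> > 0" "\<And>i. i < n \<Longrightarrow> \<epsilon> \<le> e i" using e by (auto simp: \<epsilon>_def)
    define I where "I = {0..1} \<inter> ball a \<epsilon>"
    have I: "connected I" "a \<in> I"
      using a \<epsilon> by (auto simp: I_def intro: convex_connected convex_Int)
    have kI: "continuous_on (I \<times> {t 0..t n}) k"
      by (rule continuous_on_subset[OF k]) (auto simp: I_def t)
    have "\<exists>u. horizontal (I \<times> {t 0..t n}) k u \<and> u (a, t 0) = id \<and>
        u (a, t n) = path_product w (\<lambda>s. k (a, s)) t R n"
    proof (rule horizontal_strip[OF I t(3) kI])
      show "k (q, t 0) = pathstart g" if "q \<in> I" for q
        using ends that by (auto simp: I_def pathstart_def t)
      fix i assume i: "i < n"
      with e(2)[OF i] \<epsilon>(2)[OF i] d show "small (R i) \<and> k ` (I \<times> {t i..t (Suc i)}) \<subseteq> R i"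
        by (force simp: subdivides_def I_def)
    qed
    then obtain u where u: "horizontal (I \<times> {0..1}) k u" "u (a, 0) = id" using t by auto
    have hol: "holonomy (k \<circ> Pair b) = u (a, 1)" if b: "b \<in> I" for b
    proof -
      \<comment> \<open>The edges of the strip at 0 and 1 are mapped to single points, so the lift
        over each \<open>b\<close> starts at \<open>id\<close> and ends at the same operator
        \<open>u (a, 1)\<close>.\<close>
      have end_const: "u (a, s) = u (b, s)" if "s \<in> {0, 1}" for s
      proof (rule horizontal_const_unique[of "I \<times> {s}" _ _ k u "if s = 0 then pathstart g else pathfinish g"])
        show "horizontal (I \<times> {s}) k u" by (rule horizontal_subset[OF u(1)]) (use that in auto)
        show "k z = (if s = 0 then pathstart g else pathfinish g)" if "z \<in> I \<times> {s}" for z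
          using that ends \<open>s \<in> {0, 1}\<close> by (auto simp: I_def pathstart_def pathfinish_def)
        show "connected (I \<times> {s})" by (intro connected_Times I connected_sing)
      qed (use I b in auto)
      have hor: "horizontal {0..1} (k \<circ> Pair b) (u \<circ> Pair b)"
        by (rule horizontal_compose[OF u(1)]) (use b in \<open>auto intro!: continuous_intros\<close>)
      have "holonomy (k \<circ> Pair b) = (u \<circ> Pair b) 1"
        by (rule holonomy_eq[OF path_k hor]) (use b u(2) end_const[of 0] in \<open>auto simp: I_def\<close>)
      with end_const[of 1] show ?thesis by simp
    qed
    show "\<forall>\<^sub>F b in at a within {0..1}. holonomy (k \<circ> Pair a) = holonomy (k \<circ> Pair b)"
      unfolding eventually_at using \<epsilon>(1) hol I(2)
      by (intro exI[of _ \<epsilon>]) (auto simp: I_def dist_commute)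
  qed
  \<comment> \<open>The homotopy matches \<open>g\<close> and \<open>h\<close> on the unit interval
    only, whereas paths are functions on the whole line; holonomy depends on the restriction
    alone.\<close>
  have hol_k: "holonomy g' = holonomy (k \<circ> Pair b)"
    if eq: "\<forall>s\<in>{0..1}. k (b, s) = g' s" and b: "b \<in> {0..1}" for g' b
  proof -
    obtain u where u: "horizontal {0..1} (k \<circ> Pair b) u" "u 0 = id" "u 1 = holonomy (k \<circ> Pair b)"
      using holonomy_horizontal[OF path_k[OF b]] .
    have "path g'" using path_k[OF b] unfolding path_def
      by (rule continuous_on_eq) (use eq in simp)
    moreover have "horizontal {0..1} g' u"
      by (rule horizontal_cong[THEN iffD1, OF _ _ u(1)]) (use eq in auto)
    ultimately show ?thesis using holonomy_eq[of g' u] u(2,3) by simp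
  qed
  show ?thesis using hol_k[OF k01(1)] hol_k[OF k01(2)] k_ends by simp
qed

end


subsection \<open>The fundamental groupoid\<close>

text \<open>All functions that are not paths share the empty class, whence the assumption on
  \<open>g\<close>.\<close>

lemma homotopy_class_eq_iff:
  assumes "path g"
  shows "homotopy_class g = homotopy_class h \<longleftrightarrow> homotopic_paths UNIV g h"
proof
  assume "homotopy_class g = homotopy_class h"
  moreover have "g \<in> homotopy_class g" using assms by (simp add: homotopy_class_def)
  ultimately show "homotopic_paths UNIV g h"
    by (simp add: homotopy_class_def homotopic_paths_sym)
next
  assume "homotopic_paths UNIV g h"
  then show "homotopy_class g = homotopy_class h"
    unfolding homotopy_class_def by (blast intro: homotopic_paths_trans homotopic_paths_sym)
qed

lemma homotopy_class_eqI: "homotopic_paths UNIV g h \<Longrightarrow> homotopy_class g = homotopy_class h"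
  using homotopy_class_eq_iff homotopic_paths_imp_path by blast

lemma path_classesI: "path g \<Longrightarrow> homotopy_class g \<in> path_classes (pathstart g) (pathfinish g)"
  by (auto simp: path_classes_def)

lemma path_classesE:
  assumes "c \<in> path_classes x y"
  obtains g where "path g" "pathstart g = x" "pathfinish g = y" "c = homotopy_class g"
  using assms by (auto simp: path_classes_def)

text \<open>Composites of representatives are all homotopic, so the union in
  \<open>class_comp\<close> is a single class.\<close>

lemma class_comp_homotopy_class:
  assumes g: "path g" and h: "path h" and gh: "pathfinish h = pathstart g"
  shows "class_comp (homotopy_class g) (homotopy_class h) = homotopy_class (h +++ g)"
proof -
  have "homotopy_class (h' +++ g') = homotopy_class (h +++ g)"
    if "g' \<in> homotopy_class g" "h' \<in> homotopy_class h" for g' h'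
    using that gh by (intro homotopy_class_eqI homotopic_paths_sym[OF homotopic_paths_join])
      (auto simp: homotopy_class_def)
  moreover have "g \<in> homotopy_class g" "h \<in> homotopy_class h"
    using g h by (auto simp: homotopy_class_def)
  ultimately show ?thesis unfolding class_comp_def by blast
qed

text \<open>The library states the unit and inverse laws with \<open>linepath\<close>, hence for vector
  spaces only; they are images of homotopies of paths in $[0,1]$.\<close>

lemma homotopy_class_reparametrize:
  fixes g :: "real \<Rightarrow> 'm::topological_space"
  assumes g: "path g" and p: "path p" "path_image p \<subseteq> {0..1}" and q: "path q" "path_image q \<subseteq> {0..1}"
    and ends: "pathstart p = pathstart q" "pathfinish p = pathfinish q"
  shows "homotopy_class (g \<circ> p) = homotopy_class (g \<circ> q)"
proof -
  have "closed_segment (p t) (q t) \<subseteq> {0..1}" if "t \<in> {0..1}" for t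
  proof -
    have "p t \<in> path_image p" "q t \<in> path_image q" using that by (auto simp: path_image_def)
    with p(2) q(2) show ?thesis by (intro closed_segment_subset) auto
  qed
  then have "homotopic_paths {0..1} p q"
    using p q ends by (intro homotopic_paths_linear) auto
  then show ?thesis
    using g by (intro homotopy_class_eqI homotopic_paths_continuous_image) (auto simp: path_def)
qed

lemma linepath_01_images:
  fixes g :: "real \<Rightarrow> 'm::topological_space"
  shows "g \<circ> linepath 0 1 = g" "g \<circ> linepath 1 0 = reversepath g"
    "g \<circ> linepath 0 0 = (\<lambda>_. pathstart g)" "g \<circ> linepath 1 1 = (\<lambda>_. pathfinish g)"
  by (auto simp: fun_eq_iff linepath_def reversepath_def pathstart_def pathfinish_def)

lemma homotopy_class_units:
  assumes g: "path g"
  shows "homotopy_class ((\<lambda>_. pathstart g) +++ g) = homotopy_class g"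
    and "homotopy_class (g +++ (\<lambda>_. pathfinish g)) = homotopy_class g"
    and "homotopy_class (g +++ reversepath g) = homotopy_class (\<lambda>_. pathstart g)"
proof -
  have "homotopy_class (g \<circ> (linepath 0 0 +++ linepath 0 1)) = homotopy_class (g \<circ> linepath 0 1)"
    by (rule homotopy_class_reparametrize[OF g])
      (auto simp: path_image_join closed_segment_eq_real_ivl)
  then show "homotopy_class ((\<lambda>_. pathstart g) +++ g) = homotopy_class g"
    by (simp only: path_compose_join linepath_01_images)
  have "homotopy_class (g \<circ> (linepath 0 1 +++ linepath 1 1)) = homotopy_class (g \<circ> linepath 0 1)"
    by (rule homotopy_class_reparametrize[OF g])
      (auto simp: path_image_join closed_segment_eq_real_ivl)
  then show "homotopy_class (g +++ (\<lambda>_. pathfinish g)) = homotopy_class g"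
    by (simp only: path_compose_join linepath_01_images)
  have "homotopy_class (g \<circ> (linepath 0 1 +++ linepath 1 0)) = homotopy_class (g \<circ> linepath 0 0)"
    by (rule homotopy_class_reparametrize[OF g])
      (auto simp: path_image_join closed_segment_eq_real_ivl)
  then show "homotopy_class (g +++ reversepath g) = homotopy_class (\<lambda>_. pathstart g)"
    by (simp only: path_compose_join linepath_01_images)
qed

lemma const_path_class: "homotopy_class (\<lambda>_. x) \<in> path_classes x x"
  using path_classesI[of "\<lambda>_. x"] by (simp add: path_def pathstart_def pathfinish_def)

lemma reversepath_class:
  "path g \<Longrightarrow> homotopy_class (reversepath g) \<in> path_classes (pathfinish g) (pathstart g)"
  using path_classesI[of "reversepath g"] by simp

lemma class_comp_closed:
  assumes "c \<in> path_classes x y" "d \<in> path_classes z x"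
  shows "class_comp c d \<in> path_classes z y"
proof -
  obtain g h where "path g" "pathstart g = x" "pathfinish g = y" "c = homotopy_class g"
    "path h" "pathstart h = z" "pathfinish h = x" "d = homotopy_class h"
    using assms by (meson path_classesE)
  then show ?thesis
    using path_classesI[of "h +++ g"] by (simp add: class_comp_homotopy_class)
qed

lemma class_comp_assoc:
  assumes "c \<in> path_classes x y" "d \<in> path_classes z x" "e \<in> path_classes v z"
  shows "class_comp (class_comp c d) e = class_comp c (class_comp d e)"
proof -
  obtain g h k where gh: "path g" "pathstart g = x" "pathfinish g = y" "c = homotopy_class g"
    "path h" "pathstart h = z" "pathfinish h = x" "d = homotopy_class h"
    "path k" "pathstart k = v" "pathfinish k = z" "e = homotopy_class k"
    using assms by (meson path_classesE)
  then have "homotopy_class (k +++ (h +++ g)) = homotopy_class ((k +++ h) +++ g)"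
    by (intro homotopy_class_eqI homotopic_paths_assoc) auto
  with gh show ?thesis by (simp add: class_comp_homotopy_class)
qed

lemma class_comp_const_left:
  assumes "c \<in> path_classes x y" shows "class_comp (homotopy_class (\<lambda>_. y)) c = c"
proof -
  obtain g where g: "path g" "pathfinish g = y" "c = homotopy_class g"
    using assms by (meson path_classesE)
  have "class_comp (homotopy_class (\<lambda>_. y)) c = homotopy_class (g +++ (\<lambda>_. y))"
    using g by (simp add: class_comp_homotopy_class path_def pathstart_def)
  with homotopy_class_units(2)[OF g(1)] g show ?thesis by simp
qed

lemma class_comp_const_right:
  assumes "c \<in> path_classes x y" shows "class_comp c (homotopy_class (\<lambda>_. x)) = c"
proof -
  obtain g where g: "path g" "pathstart g = x" "c = homotopy_class g"
    using assms by (meson path_classesE)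
  have "class_comp c (homotopy_class (\<lambda>_. x)) = homotopy_class ((\<lambda>_. x) +++ g)"
    using g by (simp add: class_comp_homotopy_class path_def pathfinish_def)
  with homotopy_class_units(1)[OF g(1)] g show ?thesis by simp
qed

lemma class_comp_reversepath_left:
  "path g \<Longrightarrow> class_comp (homotopy_class (reversepath g)) (homotopy_class g) = homotopy_class (\<lambda>_. pathstart g)"
  by (simp add: class_comp_homotopy_class homotopy_class_units)

lemma class_comp_reversepath_right:
  "path g \<Longrightarrow> class_comp (homotopy_class g) (homotopy_class (reversepath g)) = homotopy_class (\<lambda>_. pathfinish g)"
  using class_comp_reversepath_left[of "reversepath g"] by simp

section \<open>Change of base point\<close>

lemma change_base_closed:
  assumes \<delta>: "path \<delta>" and c: "c \<in> path_classes (pathfinish \<delta>) (pathfinish \<delta>)"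
  shows "change_base \<delta> c \<in> path_classes (pathstart \<delta>) (pathstart \<delta>)"
  unfolding change_base_def
  by (intro class_comp_closed[OF reversepath_class[OF \<delta>]] class_comp_closed[OF c] path_classesI \<delta>)

text \<open>Shows that \<open>change_base \<delta>\<close> reaches every loop class at the new base
  point, so an equation known only for its values holds for all loops there.\<close>

lemma change_base_reversepath:
  assumes \<delta>: "path \<delta>" and c: "c \<in> path_classes (pathstart \<delta>) (pathstart \<delta>)"
  shows "change_base \<delta> (change_base (reversepath \<delta>) c) = c"
proof -
  let ?d = "homotopy_class \<delta>" and ?e = "homotopy_class (reversepath \<delta>)"
  note P = path_classesI[OF \<delta>] reversepath_class[OF \<delta>] c
  note C = class_comp_closed
  have "change_base \<delta> (change_base (reversepath \<delta>) c) =
      class_comp ?e (class_comp (class_comp ?d (class_comp c ?e)) ?d)"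
    by (simp add: change_base_def)
  also have "class_comp (class_comp ?d (class_comp c ?e)) ?d = class_comp ?d (class_comp (class_comp c ?e) ?d)"
    by (rule class_comp_assoc[OF P(1) C[OF P(3,2)] P(1)])
  also have "class_comp (class_comp c ?e) ?d = class_comp c (class_comp ?e ?d)"
    by (rule class_comp_assoc[OF P(3,2,1)])
  also have "\<dots> = c"
    using class_comp_const_right[OF c] \<delta> by (simp add: class_comp_reversepath_left)
  also have "class_comp ?e (class_comp ?d c) = class_comp (class_comp ?e ?d) c"
    by (rule class_comp_assoc[OF P(2,1,3), symmetric])
  also have "\<dots> = c"
    using class_comp_const_left[OF c] \<delta> by (simp add: class_comp_reversepath_left)
  finally show ?thesis .
qed


subsection \<open>Transport systems and their loop representations\<close>

lemma transport_unitary: "transport_system W \<Longrightarrow> c \<in> path_classes x y \<Longrightarrow> unitary (W y x c)"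
  by (auto simp: transport_system_def)

lemma transport_comp:
  "transport_system W \<Longrightarrow> c \<in> path_classes x y \<Longrightarrow> d \<in> path_classes z x \<Longrightarrow>
    W y x c \<circ> W x z d = W y z (class_comp c d)"
  by (auto simp: transport_system_def)

text \<open>The composition law makes this operator idempotent, and it is invertible.\<close>

lemma transport_const:
  assumes W: "transport_system W" shows "W x x (homotopy_class (\<lambda>_. x)) = id"
proof -
  let ?U = "W x x (homotopy_class (\<lambda>_. x))"
  have U: "unitary ?U" by (rule transport_unitary[OF W const_path_class])
  have "?U \<circ> ?U = ?U"
    using transport_comp[OF W const_path_class const_path_class]
    by (simp add: class_comp_const_left[OF const_path_class])
  then have "?U v = v" for v
    using inv_op_left[OF U, of "?U v"] inv_op_left[OF U, of v] by (simp add: fun_eq_iff)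
  then show ?thesis by (simp add: fun_eq_iff)
qed

lemma transport_inv:
  assumes W: "transport_system W" and \<delta>: "path \<delta>" "pathstart \<delta> = x" "pathfinish \<delta> = y"
  shows "inv_op (W y x (homotopy_class \<delta>)) = W x y (homotopy_class (reversepath \<delta>))"
proof -
  have P: "homotopy_class \<delta> \<in> path_classes x y" "homotopy_class (reversepath \<delta>) \<in> path_classes y x"
    using path_classesI[of \<delta>] reversepath_class[of \<delta>] \<delta> by auto
  have "W y x (homotopy_class \<delta>) \<circ> W x y (homotopy_class (reversepath \<delta>)) = id"
    using transport_comp[OF W P] transport_const[OF W, of y] \<delta>
    by (simp add: class_comp_reversepath_right)
  then show ?thesis by (rule inv_op_unique[OF transport_unitary[OF W P(1)]])
qed

lemma loop_rep_hom:
  assumes W: "transport_system W" shows "loop_rep W x \<in> hom (pi1 x) unitary_group"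
proof (rule homI)
  fix c assume "c \<in> carrier (pi1 x)"
  then show "loop_rep W x c \<in> carrier unitary_group"
    using transport_unitary[OF W] by (simp add: pi1_def loop_rep_def unitary_group_def)
next
  fix c d assume "c \<in> carrier (pi1 x)" "d \<in> carrier (pi1 x)"
  then show "loop_rep W x (c \<otimes>\<^bsub>pi1 x\<^esub> d) = loop_rep W x c \<otimes>\<^bsub>unitary_group\<^esub> loop_rep W x d"
    using transport_comp[OF W] by (simp add: pi1_def loop_rep_def unitary_group_def)
qed

text \<open>The composition law splits the transported loop into three factors, the outer two being
  inverse to each other. This conjugation is the unitary required by
  \<open>rep_equiv\<close>.\<close>

lemma loop_rep_change_base:
  assumes W: "transport_system W" and \<delta>: "path \<delta>" "pathstart \<delta> = x'" "pathfinish \<delta> = x"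
    and c: "c \<in> path_classes x x"
  shows "loop_rep W x' (change_base \<delta> c) =
    W x' x (homotopy_class (reversepath \<delta>)) \<circ> loop_rep W x c \<circ> inv_op (W x' x (homotopy_class (reversepath \<delta>)))"
proof -
  have P: "homotopy_class \<delta> \<in> path_classes x' x" "homotopy_class (reversepath \<delta>) \<in> path_classes x x'"
    using path_classesI[of \<delta>] reversepath_class[of \<delta>] \<delta> by auto
  have "inv_op (W x' x (homotopy_class (reversepath \<delta>))) = W x x' (homotopy_class \<delta>)"
    using transport_inv[OF W, of "reversepath \<delta>" x x'] \<delta> by simp
  then show ?thesis
    unfolding change_base_def loop_rep_def
    using transport_comp[OF W P(2) class_comp_closed[OF c P(1)]] transport_comp[OF W c P(1)]
    by (simp add: comp_assoc)
qed

lemma loop_rep_equiv: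
  assumes W: "transport_system W" and \<delta>: "path \<delta>" "pathstart \<delta> = x'" "pathfinish \<delta> = x"
  shows "((x, loop_rep W x), (x', loop_rep W x')) \<in> rep_equiv"
proof -
  have "unitary (W x' x (homotopy_class (reversepath \<delta>)))"
    using transport_unitary[OF W] reversepath_class[of \<delta>] \<delta> by blast
  then show ?thesis
    using loop_rep_hom[OF W] loop_rep_change_base[OF W \<delta>] \<delta>
    unfolding rep_equiv_def based_reps_def by (auto simp: pi1_def)
qed


subsection \<open>Segments in charts\<close>

lemma smooth_atlas_chart_ball:
  assumes A: "smooth_atlas A"
  obtains U \<phi> r where "(U, \<phi>) \<in> A" "is_chart (U, \<phi>)" "x \<in> U" "0 < r" "ball (\<phi> x) r \<subseteq> \<phi> ` U"
proof -
  obtain U \<phi> where U: "(U, \<phi>) \<in> A" "x \<in> U"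
    using A unfolding smooth_atlas_def by (metis UNIV_I UN_E prod.collapse)
  have ch: "is_chart (U, \<phi>)" using A U by (auto simp: smooth_atlas_def)
  then have "open (\<phi> ` U)" by (simp add: is_chart_def)
  then obtain r where "r > 0" "ball (\<phi> x) r \<subseteq> \<phi> ` U" using U by (meson imageI openE)
  with that U ch show thesis by blast
qed

text \<open>A straight segment in coordinates depends explicitly and continuously on both ends, as
  the families of paths in \<open>weakly_measurable_transport\<close> must. The arguments are
  ordered as in \<open>W y x\<close>: the path runs from \<open>x\<close> to
  \<open>y\<close>.\<close>

definition chart_segment :: "'m set \<Rightarrow> ('m \<Rightarrow> 'e::real_normed_vector) \<Rightarrow> 'm \<Rightarrow> 'm \<Rightarrow> real \<Rightarrow> 'm" where
  "chart_segment U \<phi> y x = inv_into U \<phi> \<circ> linepath (\<phi> x) (\<phi> y)"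

lemma chart_segment_ends:
  assumes "is_chart (U, \<phi>)" "x \<in> U" "y \<in> U"
  shows "pathstart (chart_segment U \<phi> y x) = x" "pathfinish (chart_segment U \<phi> y x) = y"
  using assms is_chart_inj_on[of U \<phi>]
  by (simp_all add: chart_segment_def pathstart_compose pathfinish_compose)

text \<open>Convexity of \<open>B\<close> keeps the segments inside the image of the chart, where
  its inverse is continuous.\<close>

lemma chart_segment_continuous:
  fixes \<phi> :: "'m::topological_space \<Rightarrow> 'e::euclidean_space"
  assumes ch: "is_chart (U, \<phi>)" and B: "convex B" "B \<subseteq> \<phi> ` U"
  shows "continuous_on (((U \<inter> \<phi> -` B) \<times> (U \<inter> \<phi> -` B)) \<times> {0..1}) (\<lambda>(p, s). chart_segment U \<phi> (fst p) (snd p) s)"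
proof -
  let ?O = "U \<inter> \<phi> -` B"
  have c: "continuous_on ((?O \<times> ?O) \<times> {0..1}) (\<lambda>z. \<phi> (f z))"
    if "continuous_on ((?O \<times> ?O) \<times> {0..1}) f" "f ` ((?O \<times> ?O) \<times> {0..1}) \<subseteq> ?O" for f :: "('m \<times> 'm) \<times> real \<Rightarrow> 'm"
    by (rule continuous_on_compose2[OF is_chart_continuous[OF ch] that(1)]) (use that(2) in auto)
  have "continuous_on ((?O \<times> ?O) \<times> {0..1})
      (\<lambda>z. (1 - snd z) *\<^sub>R \<phi> (snd (fst z)) + snd z *\<^sub>R \<phi> (fst (fst z)))"
    by (intro continuous_intros c) auto
  then have "continuous_on ((?O \<times> ?O) \<times> {0..1})
      (\<lambda>z. inv_into U \<phi> ((1 - snd z) *\<^sub>R \<phi> (snd (fst z)) + snd z *\<^sub>R \<phi> (fst (fst z))))"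
  proof (rule continuous_on_compose2[OF is_chart_inv_continuous[OF ch]])
    have "(1 - s) *\<^sub>R \<phi> x + s *\<^sub>R \<phi> y \<in> B" if "x \<in> ?O" "y \<in> ?O" "s \<in> {0..1}" for x y s
      using B(1) that by (intro convexD_alt) auto
    then show "(\<lambda>z. (1 - snd z) *\<^sub>R \<phi> (snd (fst z)) + snd z *\<^sub>R \<phi> (fst (fst z))) ` ((?O \<times> ?O) \<times> {0..1}) \<subseteq> \<phi> ` U"
      using B(2) by (fastforce simp: image_subset_iff)
  qed
  then show ?thesis
    by (rule continuous_on_eq) (auto simp: chart_segment_def linepath_def)
qed

lemma chart_segment_path:
  fixes \<phi> :: "'m::topological_space \<Rightarrow> 'e::euclidean_space"
  assumes "is_chart (U, \<phi>)" "convex B" "B \<subseteq> \<phi> ` U" and xy: "x \<in> U \<inter> \<phi> -` B" "y \<in> U \<inter> \<phi> -` B"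
  shows "path (chart_segment U \<phi> y x)"
proof -
  have "continuous_on {0..1} (\<lambda>s. (\<lambda>(p, s). chart_segment U \<phi> (fst p) (snd p) s) ((y, x), s))"
    by (rule continuous_on_compose2[OF chart_segment_continuous[OF assms(1-3)]])
      (use xy in \<open>auto intro!: continuous_intros\<close>)
  then show ?thesis by (simp add: path_def)
qed

text \<open>Chart balls are joined to their centres by segments, so being reachable from
  \<open>x\<close> is a locally constant property.\<close>

lemma connected_manifold_path:
  fixes A :: "('m::topological_space, 'e::euclidean_space) chart set"
  assumes A: "smooth_atlas A" and conn: "connected (UNIV :: 'm set)"
  obtains \<delta> where "path \<delta>" "pathstart \<delta> = x" "pathfinish \<delta> = (y :: 'm)"
proof -
  have "path_component UNIV x x = path_component UNIV x y"
  proof (rule connected_local_const[OF conn], simp, simp, rule ballI)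
    fix a :: 'm
    obtain U \<phi> r where U: "(U, \<phi>) \<in> A" "is_chart (U, \<phi>)" "a \<in> U" "0 < r" "ball (\<phi> a) r \<subseteq> \<phi> ` U"
      using smooth_atlas_chart_ball[OF A] .
    have "path_component UNIV a b" if "b \<in> U \<inter> \<phi> -` ball (\<phi> a) r" for b
    proof -
      have "path (chart_segment U \<phi> b a)"
        by (rule chart_segment_path[OF U(2) convex_ball U(5)]) (use that U in auto)
      then show ?thesis
        using chart_segment_ends[OF U(2), of a b] that U(3) unfolding path_component_def by blast
    qed
    then have "path_component UNIV x a = path_component UNIV x b" if "b \<in> U \<inter> \<phi> -` ball (\<phi> a) r" for b
      using that by (meson path_component_sym path_component_trans)
    moreover have "open (U \<inter> \<phi> -` ball (\<phi> a) r)" "a \<in> U \<inter> \<phi> -` ball (\<phi> a) r"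
      using is_chart_open_vimage[OF U(2)] U by auto
    ultimately show "\<forall>\<^sub>F b in at a within UNIV. path_component UNIV x a = path_component UNIV x b"
      unfolding eventually_at_topological by blast
  qed
  moreover have "path_component UNIV x x" by (simp add: path_component_refl_eq)
  ultimately show thesis using that unfolding path_component_def by auto
qed


subsection \<open>The transport system of a local system\<close>

lemma local_systemD:
  assumes w: "local_system A w" and R: "small_region A R"
  shows "\<forall>x\<in>R. \<forall>y\<in>R. unitary (w R y x)"
    and "\<forall>x\<in>R. \<forall>y\<in>R. \<forall>z\<in>R. w R y x \<circ> w R x z = w R y z"
    and "\<forall>R'. small_region A R' \<longrightarrow> R \<subseteq> R' \<longrightarrow> (\<forall>x\<in>R. \<forall>y\<in>R. w R y x = w R' y x)"
proof -
  note D = w[unfolded local_system_def]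
  show "\<forall>x\<in>R. \<forall>y\<in>R. unitary (w R y x)"
    by (rule D[THEN conjunct1, THEN spec, THEN mp, OF R])
  show "\<forall>x\<in>R. \<forall>y\<in>R. \<forall>z\<in>R. w R y x \<circ> w R x z = w R y z"
    by (rule D[THEN conjunct2, THEN conjunct1, THEN spec, THEN mp, OF R])
  show "\<forall>R'. small_region A R' \<longrightarrow> R \<subseteq> R' \<longrightarrow> (\<forall>x\<in>R. \<forall>y\<in>R. w R y x = w R' y x)"
    using D[THEN conjunct2, THEN conjunct2, THEN conjunct2, THEN spec[of _ R]] R by simp
qed

lemma path_product_unitary:
  assumes "local_system A w" "small_subdivision A g n t R" "i \<le> n"
  shows "unitary (path_product w g t R i)"
  using assms(3)
proof (induction i)
  case 0
  show ?case by (subst path_product.simps(1)) (rule unitary_id)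
next
  case (Suc i)
  have "small_region A (R i)" "g ` {t i..t (Suc i)} \<subseteq> R i" "t i < t (Suc i)"
    using assms(2) Suc.prems by (auto simp: small_subdivision_def unit_partition_def)
  then have "unitary (w (R i) (g (t (Suc i))) (g (t i)))"
    using local_systemD(1)[OF assms(1)] by (meson atLeastAtMost_iff image_subset_iff less_imp_le order_refl)
  moreover have "unitary (path_product w g t R i)" using Suc by simp
  ultimately show ?case by (subst path_product.simps(2)) (rule unitary_comp)
qed

text \<open>Existence of a subdivision is exported along with the product formula, which would say
  nothing about a path without one.\<close>

lemma local_system_transport:
  fixes A :: "('m::topological_space, 'e::euclidean_space) chart set"
    and w :: "'m set \<Rightarrow> 'm \<Rightarrow> 'm \<Rightarrow> 'k::complex_hilbert_space \<Rightarrow> 'k"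
  assumes A: "smooth_atlas A" and w: "local_system A w"
  obtains W where "transport_system W"
    "\<And>g. path g \<Longrightarrow> \<exists>n t R. small_subdivision A g n t R"
    "\<And>g n t R. path g \<Longrightarrow> small_subdivision A g n t R \<Longrightarrow>
       path_product w g t R n = W (pathfinish g) (pathstart g) (homotopy_class g)"
proof -
  interpret flat_cocycle "small_region A" w
  proof
    show "open R" if "small_region A R" for R using that by (simp add: small_region_def)
    show "\<exists>R. small_region A R \<and> x \<in> R \<and> R \<subseteq> N" if "open N" "x \<in> N" for N x
      using small_region_basis[OF A that] by blast
    show "bij (w R y x)" if "small_region A R" "x \<in> R" "y \<in> R" for R x y
      by (rule unitary_bij) (use local_systemD(1)[OF w that(1)] that(2,3) in blast)
    show "w R y x \<circ> w R x z = w R y z" if "small_region A R" "x \<in> R" "y \<in> R" "z \<in> R" for R x y z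
      by (rule local_systemD(2)[OF w that(1), rule_format]) (rule that)+
    show "w R y x = w R' y x"
      if "small_region A R" "small_region A R'" "R \<subseteq> R'" "x \<in> R" "y \<in> R" for R R' x y
      by (rule local_systemD(3)[OF w that(1), rule_format]) (rule that)+
  qed
  have sub: "subdivides g n t R = small_subdivision A g n t R" for g n t R
    by (simp add: subdivides_def small_subdivision_def)
  have exists: "\<exists>n t R. small_subdivision A g n t R" if g: "path g" for g
  proof -
    obtain n t R where "subdivides g n t R" using subdivides_exists[OF g] .
    then show ?thesis unfolding sub by (intro exI)
  qed
  \<comment> \<open>Any member of the class will do, by homotopy invariance; the class already
    determines its endpoints.\<close>
  define W :: "('m, 'k) transport" where "W y x c = holonomy (SOME g. g \<in> c)" for y x c
  have W: "W y x (homotopy_class g) = holonomy g" if "path g" for x y g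
  proof -
    have "\<exists>h. h \<in> homotopy_class g" using that by (intro exI[of _ g]) (simp add: homotopy_class_def)
    from someI_ex[OF this] show ?thesis
      unfolding W_def using holonomy_homotopic[of g "SOME h. h \<in> homotopy_class g"]
      by (simp add: homotopy_class_def)
  qed
  have "transport_system W"
    unfolding transport_system_def
  proof (intro conjI allI ballI)
    fix x y :: 'm and c assume "c \<in> path_classes x y"
    then obtain g where g: "path g" "c = homotopy_class g" by (meson path_classesE)
    obtain n t R where "small_subdivision A g n t R" using exists[OF g(1)] by blast
    then have "unitary (path_product w g t R n)" "path_product w g t R n = holonomy g"
      using path_product_unitary[OF w] holonomy_path_product[OF g(1), unfolded sub] by simp_all
    then show "unitary (W y x c)" unfolding g(2) W[OF g(1)] by simp
  next
    fix x y z :: 'm and c d assume "c \<in> path_classes x y" "d \<in> path_classes z x"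
    then obtain g h where "path g" "pathstart g = x" "pathfinish g = y" "c = homotopy_class g"
      "path h" "pathstart h = z" "pathfinish h = x" "d = homotopy_class h"
      by (meson path_classesE)
    then show "W y x c \<circ> W x z d = W y z (class_comp c d)"
      by (simp only: W holonomy_join class_comp_homotopy_class path_join)
  qed
  moreover have "path_product w g t R n = W (pathfinish g) (pathstart g) (homotopy_class g)"
    if "path g" "small_subdivision A g n t R" for g n t R
    unfolding W[OF that(1)] by (rule holonomy_path_product[OF that(1) that(2)[folded sub], symmetric])
  ultimately show thesis using exists by (intro that)
qed


subsection \<open>Weak measurability\<close>

lemma norm_diff_cinner: "(norm (x - y))\<^sup>2 = (norm x)\<^sup>2 + (norm y)\<^sup>2 - 2 * Re (cinner x y)"
proof -
  have "cinner x (- y) = - cinner x y"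
    using cinner_diff_right[of x 0 y] cinner_diff_right[of x 0 0] by simp
  then show ?thesis using Re_cinner[of x "- y"] by simp
qed

lemma separable_dense_sequence:
  assumes "separable_space (euclidean :: 'k::complex_hilbert_space topology)"
  obtains d :: "nat \<Rightarrow> 'k::complex_hilbert_space" where "\<And>x e. 0 < e \<Longrightarrow> \<exists>j. norm (x - d j) < e"
proof -
  obtain D :: "'k set" where D: "countable D" "closure D = UNIV"
    using assms by (auto simp: separable_space_def)
  then have "D \<noteq> {}" by auto
  have "\<exists>j. norm (x - from_nat_into D j) < e" if e: "0 < e" for x e
  proof -
    have "x \<in> closure D" using D by simp
    then obtain y where "y \<in> D" "dist y x < e"
      using e unfolding closure_approachable by blast
    then show ?thesis
      using D(1) by (intro exI[of _ "to_nat_on D y"]) (simp add: dist_norm norm_minus_commute)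
  qed
  then show thesis by (rule that)
qed

text \<open>The constant norm makes \<open>norm (F z - d j) < e\<close> a condition on the single matrix
  element \<open>cinner (d j) (F z)\<close>, so no orthonormal basis is needed.\<close>

lemma weakly_measurable_cinner:
  fixes F G :: "'a \<Rightarrow> 'k::complex_hilbert_space"
  assumes sep: "separable_space (euclidean :: 'k topology)"
    and F: "\<And>\<xi>. (\<lambda>z. cinner \<xi> (F z)) \<in> borel_measurable M"
    and G: "\<And>\<xi>. (\<lambda>z. cinner \<xi> (G z)) \<in> borel_measurable M"
    and norm_F: "\<And>z. z \<in> space M \<Longrightarrow> norm (F z) = c"
  shows "(\<lambda>z. cinner (F z) (G z)) \<in> borel_measurable M"
proof -
  obtain d :: "nat \<Rightarrow> 'k" where d: "\<And>x e. 0 < e \<Longrightarrow> \<exists>j. norm (x - d j) < e"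
    using separable_dense_sequence[OF sep] by blast
  define near where "near n j z \<longleftrightarrow>
    (norm (d j))\<^sup>2 + c\<^sup>2 - 2 * Re (cinner (d j) (F z)) < (inverse (real (Suc n)))\<^sup>2" for n j z
  have near: "near n j z \<longleftrightarrow> norm (F z - d j) < inverse (real (Suc n))" if "z \<in> space M" for n j z
  proof -
    have "near n j z \<longleftrightarrow> (norm (d j - F z))\<^sup>2 < (inverse (real (Suc n)))\<^sup>2"
      by (simp add: near_def norm_diff_cinner norm_F[OF that])
    also have "\<dots> \<longleftrightarrow> norm (d j - F z) < inverse (real (Suc n))"
      by (auto intro: power_strict_mono power_less_imp_less_base)
    finally show ?thesis by (simp add: norm_minus_commute)
  qed
  \<comment> \<open>The first dense vector close to \<open>F z\<close>: being least makes the choice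
    measurable, and the countable range lets \<open>cinner (d (J n z)) (G z)\<close> be handled one
    index at a time.\<close>
  define J where "J n z = (LEAST j. near n j z)" for n z
  have Re_meas [measurable]: "(\<lambda>z. Re (cinner (d j) (F z))) \<in> borel_measurable M" for j
    using F by (rule measurable_compose[OF _ borel_measurable_Re])
  have J_meas: "J n \<in> measurable M (count_space UNIV)" for n
    unfolding J_def near_def
    by measurable
  have J: "norm (F z - d (J n z)) < inverse (real (Suc n))" if z: "z \<in> space M" for n z
  proof -
    obtain j where "near n j z" using d[of "inverse (real (Suc n))" "F z"] near[OF z] by auto
    then have "near n (J n z) z" unfolding J_def by (rule LeastI)
    then show ?thesis using near[OF z] by simp
  qed
  show ?thesis
  proof (rule borel_measurable_LIMSEQ_metric)
    show "(\<lambda>z. cinner (d (J n z)) (G z)) \<in> borel_measurable M" for n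
      by (rule measurable_compose_countable[OF G J_meas])
    show "(\<lambda>n. cinner (d (J n z)) (G z)) \<longlonglongrightarrow> cinner (F z) (G z)" if "z \<in> space M" for z
    proof (intro tendsto_cinner tendsto_const)
      have "(\<lambda>n. d (J n z) - F z) \<longlonglongrightarrow> 0"
      proof (rule Lim_null_comparison[OF _ LIMSEQ_inverse_real_of_nat])
        show "\<forall>\<^sub>F n in sequentially. norm (d (J n z) - F z) \<le> inverse (real (Suc n))"
          using J[OF that] by (auto intro!: always_eventually less_imp_le simp: norm_minus_commute)
      qed
      then show "(\<lambda>n. d (J n z)) \<longlonglongrightarrow> F z" by (simp add: LIM_zero_iff)
    qed
  qed
qed

lemma dense_sequence_limit:
  assumes d: "\<And>x e. 0 < e \<Longrightarrow> \<exists>j. norm (x - d j) < e"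
  obtains J where "(\<lambda>n. d (J n)) \<longlonglongrightarrow> (x :: 'a::real_normed_vector)"
proof -
  have "\<forall>n. \<exists>j. norm (x - d j) < inverse (real (Suc n))" using d by simp
  then obtain J where J: "\<And>n. norm (x - d (J n)) < inverse (real (Suc n))" by metis
  have "(\<lambda>n. d (J n) - x) \<longlonglongrightarrow> 0"
  proof (rule Lim_null_comparison[OF _ LIMSEQ_inverse_real_of_nat])
    show "\<forall>\<^sub>F n in sequentially. norm (d (J n) - x) \<le> inverse (real (Suc n))"
      using J by (auto intro!: always_eventually less_imp_le simp: norm_minus_commute)
  qed
  then show thesis by (intro that[of J]) (simp add: LIM_zero_iff)
qed

text \<open>Unitaries are isometric, so every matrix element is a pointwise limit of those between
  dense vectors. Countably many conditions then suffice, and hence a single null set.\<close>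

lemma weakly_measurable_dense:
  fixes U :: "'a \<Rightarrow> 'k::complex_hilbert_space \<Rightarrow> 'k"
  assumes d: "\<And>(x::'k) e. 0 < e \<Longrightarrow> \<exists>j. norm (x - d j) < e"
    and U: "\<And>z. z \<in> space M \<Longrightarrow> unitary (U z)"
    and meas: "\<And>i j :: nat. (\<lambda>z. cinner (d i) (U z (d j))) \<in> borel_measurable M"
  shows "(\<lambda>z. cinner \<xi> (U z \<eta>)) \<in> borel_measurable M"
proof -
  obtain I where I: "(\<lambda>n. d (I n)) \<longlonglongrightarrow> \<xi>" using dense_sequence_limit[OF d] .
  obtain J where J: "(\<lambda>n. d (J n)) \<longlonglongrightarrow> \<eta>" using dense_sequence_limit[OF d] .
  show ?thesis
  proof (rule borel_measurable_LIMSEQ_metric[OF meas])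
    fix z assume z: "z \<in> space M"
    have "(\<lambda>n. norm (d (J n) - \<eta>)) \<longlonglongrightarrow> 0"
      using J by (simp add: LIM_zero_iff tendsto_norm_zero)
    then have "(\<lambda>n. norm (U z (d (J n)) - U z \<eta>)) \<longlonglongrightarrow> 0"
      by (simp add: unitary_norm[OF U[OF z]] flip: unitary_diff[OF U[OF z]])
    then have "(\<lambda>n. U z (d (J n))) \<longlonglongrightarrow> U z \<eta>"
      by (simp add: tendsto_norm_zero_iff LIM_zero_iff)
    with I show "(\<lambda>n. cinner (d (I n)) (U z (d (J n)))) \<longlonglongrightarrow> cinner \<xi> (U z \<eta>)"
      by (rule tendsto_cinner)
  qed
qed

section \<open>Slices and null sets in Euclidean space\<close>

text \<open>A Lebesgue set is a Borel set plus a part of a Borel null set. Slices of the former are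
  always Borel; by Fubini almost every slice of the latter is null, and completeness absorbs its
  subsets.\<close>

lemma AE_slice_lebesgue:
  fixes Q :: "('a::euclidean_space \<times> 'b::euclidean_space) set"
  assumes "Q \<in> sets lebesgue"
  shows "AE a in lborel. {b. (a, b) \<in> Q} \<in> sets lebesgue"
proof -
  obtain S N N' where Q: "Q = S \<union> N" "N \<subseteq> N'" "N' \<in> null_sets lborel" "S \<in> sets lborel"
    using assms by (rule sets_completionE)
  have "AE z in lborel \<Otimes>\<^sub>M lborel. z \<notin> N'"
    using Q(3) by (simp add: lborel_prod AE_not_in)
  then have "AE a in lborel. AE b in lborel. (a, b) \<notin> N'"
    by (rule lborel_pair.AE_pair)
  then show ?thesis
  proof eventually_elim
    case (elim a)
    have slice: "{b. (a, b) \<in> X} \<in> sets lborel" if "X \<in> sets lborel" for X :: "('a \<times> 'b) set"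
      using sets_Pair1[of X lborel lborel a] that by (simp add: lborel_prod vimage_def)
    have "N' \<in> sets lborel" using Q(3) by auto
    then have "{b. (a, b) \<in> N'} \<in> null_sets lborel"
      using elim by (subst AE_iff_null_sets[OF slice]) auto
    then have "{b. (a, b) \<in> N} \<in> sets lebesgue"
      by (rule sets_completionI_sub) (use Q(2) in auto)
    moreover have "{b. (a, b) \<in> S} \<in> sets lebesgue"
      using slice[OF Q(4)] by (rule sets_completionI_sets)
    moreover have "{b. (a, b) \<in> Q} = {b. (a, b) \<in> S} \<union> {b. (a, b) \<in> N}" using Q(1) by auto
    ultimately show ?case by simp
  qed
qed

text \<open>A nonempty open set is not negligible, so it is not contained in the exceptional null
  set.\<close>

lemma AE_lborel_in_open:
  fixes B :: "'a::euclidean_space set"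
  assumes "AE a in lborel. P a" "open B" "B \<noteq> {}"
  obtains a where "a \<in> B" "P a"
proof -
  obtain N where N: "{a \<in> space lborel. \<not> P a} \<subseteq> N" "emeasure lborel N = 0" "N \<in> sets lborel"
    using assms(1) by (rule AE_E)
  then have "N \<in> null_sets lebesgue" by (auto intro: null_sets_completionI)
  then have "negligible N" by (simp add: negligible_iff_null_sets)
  then have "\<not> B \<subseteq> N" using open_not_negligible[OF assms(2,3)] negligible_subset by blast
  with N(1) that show thesis by auto
qed

section \<open>The Lebesgue sigma-algebra of the manifold and of its square\<close>

text \<open>The generating family is already a sigma-algebra: injectivity of the charts turns
  complements into differences inside the measurable chart images.\<close>

lemma sets_lebesgue_sets:
  assumes B: "\<And>U \<phi>. (U, \<phi>) \<in> B \<Longrightarrow> inj_on \<phi> U \<and> \<phi> ` U \<in> sets lebesgue"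
  shows "sets (lebesgue_sets B) = {S. \<forall>(U, \<phi>)\<in>B. \<phi> ` (S \<inter> U) \<in> sets lebesgue}"
  unfolding lebesgue_sets_def
proof (rule sigma_algebra.sets_measure_of_eq, subst sigma_algebra_iff2, intro conjI ballI allI impI)
  let ?C = "{S. \<forall>(U, \<phi>)\<in>B. \<phi> ` (S \<inter> U) \<in> sets lebesgue}"
  show "UNIV - S \<in> ?C" if "S \<in> ?C" for S
  proof clarify
    fix U \<phi> assume U: "(U, \<phi>) \<in> B"
    have "\<phi> ` ((UNIV - S) \<inter> U) = \<phi> ` U - \<phi> ` (S \<inter> U)"
      using B[OF U] by (auto dest: inj_onD)
    then show "\<phi> ` ((UNIV - S) \<inter> U) \<in> sets lebesgue" using that B[OF U] U by auto
  qed
  show "(\<Union>i::nat. X i) \<in> ?C" if "range X \<subseteq> ?C" for X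
  proof clarify
    fix U \<phi> assume U: "(U, \<phi>) \<in> B"
    have "\<phi> ` ((\<Union>i. X i) \<inter> U) = (\<Union>i. \<phi> ` (X i \<inter> U))" by auto
    moreover have "\<phi> ` (X i \<inter> U) \<in> sets lebesgue" for i
    proof -
      have "X i \<in> ?C" using that by (rule subsetD) (rule rangeI)
      with U show ?thesis by auto
    qed
    ultimately show "\<phi> ` ((\<Union>i. X i) \<inter> U) \<in> sets lebesgue" by (simp only:) (rule sets.countable_UN, auto)
  qed
qed auto

lemma space_lebesgue_sets: "space (lebesgue_sets B) = UNIV"
  by (simp add: lebesgue_sets_def)

lemma sets_lebesgue_sets_atlas:
  assumes "smooth_atlas A"
  shows "sets (lebesgue_sets A) = {S. \<forall>(U, \<phi>)\<in>A. \<phi> ` (S \<inter> U) \<in> sets lebesgue}"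
proof (rule sets_lebesgue_sets, intro conjI)
  fix U \<phi> assume "(U, \<phi>) \<in> A"
  then have ch: "is_chart (U, \<phi>)" using assms by (auto simp: smooth_atlas_def)
  then show "inj_on \<phi> U" by (rule is_chart_inj_on)
  show "\<phi> ` U \<in> sets lebesgue" using ch by (auto simp: is_chart_def)
qed

lemma map_prod_image: "map_prod f g ` (X \<times> Y) = f ` X \<times> g ` Y"
  by auto

lemma sets_lebesgue_sets_prod_atlas:
  assumes "smooth_atlas A"
  shows "sets (lebesgue_sets (prod_atlas A A)) =
    {S. \<forall>(U, \<phi>)\<in>prod_atlas A A. \<phi> ` (S \<inter> U) \<in> sets lebesgue}"
proof (rule sets_lebesgue_sets, intro conjI)
  fix U \<phi> assume "(U, \<phi>) \<in> prod_atlas A A"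
  then obtain U1 \<phi>1 U2 \<phi>2 where U: "U = U1 \<times> U2" "\<phi> = map_prod \<phi>1 \<phi>2" "(U1, \<phi>1) \<in> A" "(U2, \<phi>2) \<in> A"
    by (auto simp: prod_atlas_def)
  then have ch: "is_chart (U1, \<phi>1)" "is_chart (U2, \<phi>2)" using assms by (auto simp: smooth_atlas_def)
  show "inj_on \<phi> U" unfolding U by (intro map_prod_inj_on is_chart_inj_on ch)
  have "open (\<phi> ` U)" using ch by (auto simp: U map_prod_image is_chart_def intro: open_Times)
  then show "\<phi> ` U \<in> sets lebesgue" by auto
qed

lemma open_in_lebesgue_sets:
  assumes A: "smooth_atlas A" and N: "open N" shows "N \<in> sets (lebesgue_sets A)"
  unfolding sets_lebesgue_sets_atlas[OF A]
proof clarify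
  fix U \<phi> assume "(U, \<phi>) \<in> A"
  then have "is_chart (U, \<phi>)" using A by (auto simp: smooth_atlas_def)
  from is_chart_open_image[OF this N] show "\<phi> ` (N \<inter> U) \<in> sets lebesgue"
    by (auto simp: Int_commute)
qed

lemma open_Times_in_lebesgue_sets:
  assumes A: "smooth_atlas A" and N: "open N" "open N'"
  shows "N \<times> N' \<in> sets (lebesgue_sets (prod_atlas A A))"
  unfolding sets_lebesgue_sets_prod_atlas[OF A]
proof clarify
  fix U \<phi> assume "(U, \<phi>) \<in> prod_atlas A A"
  then obtain U1 \<phi>1 U2 \<phi>2 where U: "U = U1 \<times> U2" "\<phi> = map_prod \<phi>1 \<phi>2" "(U1, \<phi>1) \<in> A" "(U2, \<phi>2) \<in> A"
    by (auto simp: prod_atlas_def)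
  then have ch: "is_chart (U1, \<phi>1)" "is_chart (U2, \<phi>2)" using A by (auto simp: smooth_atlas_def)
  have "\<phi> ` (N \<times> N' \<inter> U) = \<phi>1 ` (U1 \<inter> N) \<times> \<phi>2 ` (U2 \<inter> N')"
    by (simp add: U Times_Int_Times map_prod_image Int_commute)
  moreover have "open (\<phi>1 ` (U1 \<inter> N) \<times> \<phi>2 ` (U2 \<inter> N'))"
    by (intro open_Times is_chart_open_image ch N)
  ultimately show "\<phi> ` (N \<times> N' \<inter> U) \<in> sets lebesgue" by simp
qed

text \<open>Measurability in one chart suffices, because the transition maps are differentiable.\<close>

lemma chart_image_in_lebesgue_sets:
  assumes A: "smooth_atlas A" and U: "(U, \<phi>) \<in> A" and X: "X \<subseteq> U" "\<phi> ` X \<in> sets lebesgue"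
  shows "X \<in> sets (lebesgue_sets A)"
  unfolding sets_lebesgue_sets_atlas[OF A]
proof clarify
  fix V \<psi> assume V: "(V, \<psi>) \<in> A"
  have ch: "is_chart (U, \<phi>)" "is_chart (V, \<psi>)" using A U V by (auto simp: smooth_atlas_def)
  have "open V" using ch by (simp add: is_chart_def)
  have "smooth_on (\<phi> ` (U \<inter> V)) (\<psi> \<circ> inv_into U \<phi>)"
    using A U V unfolding smooth_atlas_def smooth_transition_def by blast
  then have "Ck_on (Suc 0) (\<psi> \<circ> inv_into U \<phi>) (\<phi> ` (U \<inter> V))" unfolding smooth_on_def by blast
  then have d: "(\<psi> \<circ> inv_into U \<phi>) differentiable_on (\<phi> ` (U \<inter> V))"
    by (auto simp: differentiable_on_def intro: differentiable_at_withinI)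
  have "open (\<phi> ` (U \<inter> V))" by (rule is_chart_open_image[OF ch(1) \<open>open V\<close>])
  moreover have "\<phi> ` (X \<inter> V) = \<phi> ` X \<inter> \<phi> ` (U \<inter> V)"
    using X(1) is_chart_inj_on[OF ch(1)] by (auto dest: inj_onD)
  ultimately have "\<phi> ` (X \<inter> V) \<in> sets lebesgue" using X(2) by auto
  \<comment> \<open>A differentiable map between spaces of equal dimension preserves null sets, and
    with them Lebesgue measurability.\<close>
  then have "(\<psi> \<circ> inv_into U \<phi>) ` (\<phi> ` (X \<inter> V)) \<in> sets lebesgue"
    by (rule differentiable_image_in_sets_lebesgue)
      (use X(1) in \<open>auto intro: differentiable_on_subset[OF d]\<close>)
  moreover have "(\<psi> \<circ> inv_into U \<phi>) ` (\<phi> ` (X \<inter> V)) = \<psi> ` (X \<inter> V)"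
    using X(1) is_chart_inj_on[OF ch(1)] by (force simp: image_image)
  ultimately show "\<psi> ` (X \<inter> V) \<in> sets lebesgue" by simp
qed

section \<open>Measurable slices of the transport operators\<close>

text \<open>In coordinates this is the slicing of preimages of open sets. A countable basis of the
  complex plane leaves countably many preimages, so the exceptional null sets unite to a null
  set.\<close>

lemma AE_slice_measurable:
  fixes A :: "('m::topological_space, 'e::euclidean_space) chart set" and F :: "'m \<times> 'm \<Rightarrow> complex"
  assumes A: "smooth_atlas A" and U: "(U, \<phi>) \<in> A" and B: "open B" "B \<subseteq> \<phi> ` U"
    and N_def: "N = U \<inter> \<phi> -` B"
    and F: "F \<in> borel_measurable (restrict_space (lebesgue_sets (prod_atlas A A)) (N \<times> N))"
  shows "AE a in lborel. a \<in> B \<longrightarrow>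
    (\<lambda>x. F (inv_into U \<phi> a, x)) \<in> borel_measurable (restrict_space (lebesgue_sets A) N)"
proof -
  let ?M = "lebesgue_sets (prod_atlas A A)"
  have ch: "is_chart (U, \<phi>)" using A U by (auto simp: smooth_atlas_def)
  note inj = is_chart_inj_on[OF ch]
  have N: "open N" using is_chart_open_vimage[OF ch B(1)] by (simp add: N_def)
  obtain \<G> :: "complex set set" where \<G>: "countable \<G>" "topological_basis \<G>"
    using ex_countable_basis by blast
  define Q where "Q G = map_prod \<phi> \<phi> ` {p \<in> N \<times> N. F p \<in> G}" for G
  have "Q G \<in> sets lebesgue" if "G \<in> \<G>" for G
  proof -
    have "open G" using \<G>(2) that by (rule topological_basis_open)
    then have "F -` G \<inter> space (restrict_space ?M (N \<times> N)) \<in> sets (restrict_space ?M (N \<times> N))"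
      by (intro measurable_sets[OF F]) auto
    moreover have "F -` G \<inter> space (restrict_space ?M (N \<times> N)) = {p \<in> N \<times> N. F p \<in> G}"
      by (auto simp: space_restrict_space space_lebesgue_sets)
    ultimately have "{p \<in> N \<times> N. F p \<in> G} \<in> sets ?M"
      using open_Times_in_lebesgue_sets[OF A N N]
      by (subst (asm) sets_restrict_space_iff) (auto simp: space_lebesgue_sets)
    moreover have "(U \<times> U, map_prod \<phi> \<phi>) \<in> prod_atlas A A"
      using U by (auto simp: prod_atlas_def)
    ultimately have "map_prod \<phi> \<phi> ` ({p \<in> N \<times> N. F p \<in> G} \<inter> U \<times> U) \<in> sets lebesgue"
      unfolding sets_lebesgue_sets_prod_atlas[OF A] by blast
    moreover have "{p \<in> N \<times> N. F p \<in> G} \<inter> U \<times> U = {p \<in> N \<times> N. F p \<in> G}"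
      by (auto simp: N_def)
    ultimately show ?thesis by (simp add: Q_def)
  qed
  then have "AE a in lborel. \<forall>G\<in>\<G>. {b. (a, b) \<in> Q G} \<in> sets lebesgue"
    by (intro AE_ball_countable' AE_slice_lebesgue \<G>(1))
  then show ?thesis
  proof (eventually_elim, intro impI)
    fix a assume Qa: "\<forall>G\<in>\<G>. {b. (a, b) \<in> Q G} \<in> sets lebesgue" and a: "a \<in> B"
    define y where "y = inv_into U \<phi> a"
    have y: "y \<in> N" "\<phi> y = a"
      using a B(2) by (auto simp: y_def N_def f_inv_into_f inv_into_into subset_iff)
    have "{x \<in> N. F (y, x) \<in> G} \<in> sets (lebesgue_sets A)" if "G \<in> \<G>" for G
    proof (rule chart_image_in_lebesgue_sets[OF A U])
      have "{b. (a, b) \<in> Q G} = \<phi> ` {x \<in> N. F (y, x) \<in> G}"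
      proof (intro subset_antisym subsetI)
        fix b assume "b \<in> {b. (a, b) \<in> Q G}"
        then obtain y' x where "y' \<in> N" "x \<in> N" "F (y', x) \<in> G" "a = \<phi> y'" "b = \<phi> x"
          by (auto simp: Q_def)
        moreover from this y have "y' = y" by (auto simp: N_def intro: inj_onD[OF inj])
        ultimately show "b \<in> \<phi> ` {x \<in> N. F (y, x) \<in> G}" by auto
      next
        fix b assume "b \<in> \<phi> ` {x \<in> N. F (y, x) \<in> G}"
        then show "b \<in> {b. (a, b) \<in> Q G}" using y unfolding Q_def by (force simp: image_iff)
      qed
      with Qa that show "\<phi> ` {x \<in> N. F (y, x) \<in> G} \<in> sets lebesgue" by metis
    qed (auto simp: N_def)
    then have "(\<lambda>x. F (y, x)) -` G \<inter> space (restrict_space (lebesgue_sets A) N)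
        \<in> sets (restrict_space (lebesgue_sets A) N)" if "G \<in> \<G>" for G
      using that open_in_lebesgue_sets[OF A N]
      by (subst sets_restrict_space_iff)
        (auto simp: space_restrict_space space_lebesgue_sets vimage_def Int_def conj_commute)
    then show "(\<lambda>x. F (inv_into U \<phi> a, x)) \<in> borel_measurable (restrict_space (lebesgue_sets A) N)"
      unfolding borel_eq_countable_basis[OF \<G>] y_def[symmetric]
      by (intro measurable_measure_of) auto
  qed
qed


text \<open>The order of quantifiers is the point: one null set of endpoints for all
  \<open>\<xi>\<close> and \<open>\<eta>\<close>. It is first found for pairs of dense vectors and
  then serves everywhere by \<open>weakly_measurable_dense\<close>.\<close>

lemma AE_transport_measurable:
  fixes A :: "('m::topological_space, 'e::euclidean_space) chart set"
    and W :: "('m, 'k::complex_hilbert_space) transport"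
  assumes sep: "separable_space (euclidean :: 'k topology)"
    and A: "smooth_atlas A" and U: "(U, \<phi>) \<in> A" and B: "open B" "convex B" "B \<subseteq> \<phi> ` U"
    and W: "transport_system W" "weakly_measurable_transport A W"
  shows "AE a in lborel. a \<in> B \<longrightarrow> (\<forall>\<xi> \<eta>.
    (\<lambda>x. cinner \<xi> (W (inv_into U \<phi> a) x (homotopy_class (chart_segment U \<phi> (inv_into U \<phi> a) x)) \<eta>))
      \<in> borel_measurable (restrict_space (lebesgue_sets A) (U \<inter> \<phi> -` B)))"
proof -
  define N where "N = U \<inter> \<phi> -` B"
  define \<Gamma> where "\<Gamma> p = chart_segment U \<phi> (fst p) (snd p)" for p
  have ch: "is_chart (U, \<phi>)" using A U by (auto simp: smooth_atlas_def)
  have "open N" using is_chart_open_vimage[OF ch B(1)] by (simp add: N_def)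
  have seg: "path (chart_segment U \<phi> y x)" "pathstart (chart_segment U \<phi> y x) = x"
    "pathfinish (chart_segment U \<phi> y x) = y" if "x \<in> N" "y \<in> N" for x y
    using chart_segment_path[OF ch B(2,3)] chart_segment_ends[OF ch] that by (auto simp: N_def)
  obtain d :: "nat \<Rightarrow> 'k" where d: "\<And>x e. 0 < e \<Longrightarrow> \<exists>j. norm (x - d j) < e"
    using separable_dense_sequence[OF sep] by blast
  have slice: "AE a in lborel. a \<in> B \<longrightarrow>
      (\<lambda>x. (\<lambda>(y, x). cinner \<xi> (W y x (homotopy_class (\<Gamma> (y, x))) \<eta>)) (inv_into U \<phi> a, x))
        \<in> borel_measurable (restrict_space (lebesgue_sets A) N)" for \<xi> \<eta>
  proof (rule AE_slice_measurable[OF A U B(1,3) N_def])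
    have 1: "continuous_on ((N \<times> N) \<times> {0..1}) (\<lambda>(p, s). \<Gamma> p s)"
      using chart_segment_continuous[OF ch B(2,3)] by (simp add: \<Gamma>_def N_def)
    have 2: "\<forall>(y, x)\<in>N \<times> N. pathstart (\<Gamma> (y, x)) = x \<and> pathfinish (\<Gamma> (y, x)) = y"
      using seg by (auto simp: \<Gamma>_def)
    have 3: "open (N \<times> N)" using \<open>open N\<close> by (intro open_Times)
    show "(\<lambda>(y, x). cinner \<xi> (W y x (homotopy_class (\<Gamma> (y, x))) \<eta>))
        \<in> borel_measurable (restrict_space (lebesgue_sets (prod_atlas A A)) (N \<times> N))"
      by (rule W(2)[unfolded weakly_measurable_transport_def, rule_format, OF 3 1 2[rule_format]])
  qed
  have "AE a in lborel. \<forall>i. \<forall>j. a \<in> B \<longrightarrow>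
      (\<lambda>x. (\<lambda>(y, x). cinner (d i) (W y x (homotopy_class (\<Gamma> (y, x))) (d j))) (inv_into U \<phi> a, x))
        \<in> borel_measurable (restrict_space (lebesgue_sets A) N)"
    unfolding AE_all_countable by (intro allI slice)
  then show ?thesis
    unfolding N_def[symmetric]
  proof (eventually_elim, intro impI allI)
    fix a \<xi> \<eta>
    assume meas: "\<forall>i. \<forall>j. a \<in> B \<longrightarrow>
        (\<lambda>x. (\<lambda>(y, x). cinner (d i) (W y x (homotopy_class (\<Gamma> (y, x))) (d j))) (inv_into U \<phi> a, x))
          \<in> borel_measurable (restrict_space (lebesgue_sets A) N)"
      and a: "a \<in> B"
    define y where "y = inv_into U \<phi> a"
    have y: "y \<in> N" using a B(3) by (auto simp: y_def N_def f_inv_into_f inv_into_into subset_iff)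
    show "(\<lambda>x. cinner \<xi> (W (inv_into U \<phi> a) x (homotopy_class (chart_segment U \<phi> (inv_into U \<phi> a) x)) \<eta>))
        \<in> borel_measurable (restrict_space (lebesgue_sets A) N)"
      unfolding y_def[symmetric]
    proof (rule weakly_measurable_dense[OF d])
      fix x assume "x \<in> space (restrict_space (lebesgue_sets A) N)"
      then have "x \<in> N" by (simp add: space_restrict_space)
      then show "unitary (W y x (homotopy_class (chart_segment U \<phi> y x)))"
        using path_classesI[OF seg(1)] seg(2,3) y by (intro transport_unitary[OF W(1)]) metis
    next
      fix i j
      show "(\<lambda>x. cinner (d i) (W y x (homotopy_class (chart_segment U \<phi> y x)) (d j)))
          \<in> borel_measurable (restrict_space (lebesgue_sets A) N)"
        using meas[rule_format, OF a, of i j] by (simp add: y_def \<Gamma>_def)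
    qed
  qed
qed

text \<open>The neighbourhoods are uncountably many; Lindelof extracts a countable cover, on which
  measurability can be pieced together.\<close>

lemma weakly_measurable_local:
  fixes A :: "('m::second_countable_topology, 'e::euclidean_space) chart set"
  assumes A: "smooth_atlas A"
    and loc: "\<And>z. \<exists>N. open N \<and> z \<in> N \<and>
      (\<forall>\<xi> \<eta>. (\<lambda>x. cinner \<xi> (S x \<eta>)) \<in> borel_measurable (restrict_space (lebesgue_sets A) N))"
  shows "weakly_measurable A S"
  unfolding weakly_measurable_def
proof (intro allI)
  fix \<xi> \<eta>
  define \<F> where "\<F> = {N. open N \<and>
    (\<lambda>x. cinner \<xi> (S x \<eta>)) \<in> borel_measurable (restrict_space (lebesgue_sets A) N)}"
  obtain \<F>' where \<F>': "\<F>' \<subseteq> \<F>" "countable \<F>'" "\<Union>\<F>' = \<Union>\<F>"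
    using Lindelof[of \<F>] by (auto simp: \<F>_def)
  have "\<Union>\<F> = UNIV" unfolding \<F>_def using loc by blast
  show "(\<lambda>x. cinner \<xi> (S x \<eta>)) \<in> borel_measurable (lebesgue_sets A)"
  proof (rule measurable_piecewise_restrict[OF \<F>'(2)])
    show "N \<inter> space (lebesgue_sets A) \<in> sets (lebesgue_sets A)" if "N \<in> \<F>'" for N
      using that \<F>'(1) open_in_lebesgue_sets[OF A] by (auto simp: space_lebesgue_sets \<F>_def)
    show "space (lebesgue_sets A) \<subseteq> \<Union>\<F>'" using \<F>'(3) \<open>\<Union>\<F> = UNIV\<close> by simp
    show "(\<lambda>x. cinner \<xi> (S x \<eta>)) \<in> borel_measurable (restrict_space (lebesgue_sets A) N)"
      if "N \<in> \<F>'" for N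
      using that \<F>'(1) by (auto simp: \<F>_def)
  qed
qed

text \<open>The endpoint \<open>y\<close> below is chosen outside the null set of bad slices for both systems;
  \<open>S\<close> then is measurable near \<open>z\<close> because it is determined by its value at \<open>y\<close>.\<close>

lemma intertwiner_weakly_measurable:
  fixes A :: "('m::second_countable_topology, 'e::euclidean_space) chart set"
    and W\<^sub>1 W\<^sub>2 :: "('m, 'k::complex_hilbert_space) transport"
  assumes sep: "separable_space (euclidean :: 'k topology)" and A: "smooth_atlas A"
    and W: "transport_system W\<^sub>1" "transport_system W\<^sub>2"
    and meas: "weakly_measurable_transport A W\<^sub>1" "weakly_measurable_transport A W\<^sub>2"
    and S: "\<And>z. unitary (S z)"
    and SW: "\<And>x y c. c \<in> path_classes x y \<Longrightarrow> W\<^sub>2 y x c \<circ> S x = S y \<circ> W\<^sub>1 y x c"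
  shows "weakly_measurable A S"
proof (rule weakly_measurable_local[OF A])
  fix z
  obtain U \<phi> r where U: "(U, \<phi>) \<in> A" and ch: "is_chart (U, \<phi>)" and z: "z \<in> U"
    and r: "0 < r" "ball (\<phi> z) r \<subseteq> \<phi> ` U"
    using smooth_atlas_chart_ball[OF A] .
  define N where "N = U \<inter> \<phi> -` ball (\<phi> z) r"
  define M where "M = restrict_space (lebesgue_sets A) N"
  have "AE a in lborel. (a \<in> ball (\<phi> z) r \<longrightarrow> (\<forall>\<xi> \<eta>.
      (\<lambda>x. cinner \<xi> (W\<^sub>1 (inv_into U \<phi> a) x (homotopy_class (chart_segment U \<phi> (inv_into U \<phi> a) x)) \<eta>))
        \<in> borel_measurable M)) \<and> (a \<in> ball (\<phi> z) r \<longrightarrow> (\<forall>\<xi> \<eta>.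
      (\<lambda>x. cinner \<xi> (W\<^sub>2 (inv_into U \<phi> a) x (homotopy_class (chart_segment U \<phi> (inv_into U \<phi> a) x)) \<eta>))
        \<in> borel_measurable M))"
    unfolding M_def N_def
    by (intro AE_conjI AE_transport_measurable sep A U open_ball convex_ball r W meas)
  then obtain a where a: "a \<in> ball (\<phi> z) r" and
    ma: "(a \<in> ball (\<phi> z) r \<longrightarrow> (\<forall>\<xi> \<eta>.
      (\<lambda>x. cinner \<xi> (W\<^sub>1 (inv_into U \<phi> a) x (homotopy_class (chart_segment U \<phi> (inv_into U \<phi> a) x)) \<eta>))
        \<in> borel_measurable M)) \<and> (a \<in> ball (\<phi> z) r \<longrightarrow> (\<forall>\<xi> \<eta>.
      (\<lambda>x. cinner \<xi> (W\<^sub>2 (inv_into U \<phi> a) x (homotopy_class (chart_segment U \<phi> (inv_into U \<phi> a) x)) \<eta>))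
        \<in> borel_measurable M))"
    by (rule AE_lborel_in_open[of _ "ball (\<phi> z) r"]) (use r in auto)
  define y where "y = inv_into U \<phi> a"
  define c where "c x = homotopy_class (chart_segment U \<phi> y x)" for x
  have m1: "(\<lambda>x. cinner \<xi> (W\<^sub>1 y x (c x) \<eta>)) \<in> borel_measurable M"
    and m2: "(\<lambda>x. cinner \<xi> (W\<^sub>2 y x (c x) \<eta>)) \<in> borel_measurable M" for \<xi> \<eta>
    unfolding c_def y_def using ma a by simp_all
  have y: "y \<in> N" using a r by (auto simp: y_def N_def f_inv_into_f inv_into_into subset_iff)
  have c: "c x \<in> path_classes x y" if "x \<in> N" for x
  proof -
    have "path (chart_segment U \<phi> y x)"
      using that y by (intro chart_segment_path[OF ch convex_ball r(2)]) (auto simp: N_def)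
    from path_classesI[OF this] show ?thesis
      using chart_segment_ends[OF ch, of x y] that y by (simp add: c_def N_def)
  qed
  have space_M: "space M = N" by (simp add: M_def space_restrict_space space_lebesgue_sets)
  have "(\<lambda>x. cinner \<xi> (S x \<eta>)) \<in> borel_measurable M" for \<xi> \<eta>
  proof -
    \<comment> \<open>Applying the unitary \<open>W\<^sub>2 y x (c x)\<close> to both arguments
      removes its inverse from the formula for \<open>S x\<close>. What remains pairs two weakly
      measurable vectors, the first of constant norm.\<close>
    have SF: "cinner \<xi> (S x \<eta>) = cinner (W\<^sub>2 y x (c x) \<xi>) (S y (W\<^sub>1 y x (c x) \<eta>))" if "x \<in> N" for x
    proof -
      have "W\<^sub>2 y x (c x) (S x \<eta>) = S y (W\<^sub>1 y x (c x) \<eta>)"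
        using SW[OF c[OF that]] by (simp add: fun_eq_iff)
      then show ?thesis
        using unitary_cinner[OF transport_unitary[OF W(2) c[OF that]], of \<xi> "S x \<eta>"] by simp
    qed
    have "(\<lambda>x. cinner (W\<^sub>2 y x (c x) \<xi>) (S y (W\<^sub>1 y x (c x) \<eta>))) \<in> borel_measurable M"
    proof (rule weakly_measurable_cinner[OF sep])
      show "(\<lambda>x. cinner \<zeta> (W\<^sub>2 y x (c x) \<xi>)) \<in> borel_measurable M" for \<zeta> by (rule m2)
      show "(\<lambda>x. cinner \<zeta> (S y (W\<^sub>1 y x (c x) \<eta>))) \<in> borel_measurable M" for \<zeta>
        \<comment> \<open>\<open>S y\<close> does not vary with \<open>x\<close>, so it is moved
          onto the fixed vector \<open>\<zeta>\<close>.\<close>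
        unfolding cinner_unitary_right[OF S] by (rule m1)
      show "norm (W\<^sub>2 y x (c x) \<xi>) = norm \<xi>" if "x \<in> space M" for x
        using that c by (intro unitary_norm[OF transport_unitary[OF W(2)]]) (simp add: space_M)
    qed
    then show ?thesis by (rule measurable_cong[THEN iffD2, rotated]) (simp add: SF space_M)
  qed
  moreover have "open N" using is_chart_open_vimage[OF ch open_ball] by (simp add: N_def)
  moreover have "z \<in> N" using z r by (simp add: N_def)
  ultimately show "\<exists>N. open N \<and> z \<in> N \<and>
      (\<forall>\<xi> \<eta>. (\<lambda>x. cinner \<xi> (S x \<eta>)) \<in> borel_measurable (restrict_space (lebesgue_sets A) N))"
    unfolding M_def by blast
qed


subsection \<open>Equivalence of transport systems\<close>

lemma measurably_equivalent_imp_loop_reps: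
  assumes "measurably_equivalent A W\<^sub>1 W\<^sub>2"
  shows "loop_reps_equivalent_at W\<^sub>1 W\<^sub>2 x"
proof -
  obtain S where "\<And>z. unitary (S z)"
    "\<And>x y c. c \<in> path_classes x y \<Longrightarrow> W\<^sub>2 y x c = S y \<circ> W\<^sub>1 y x c \<circ> inv_op (S x)"
    using assms unfolding measurably_equivalent_def by blast
  then show ?thesis
    unfolding loop_reps_equivalent_at_def loop_rep_def pi1_def
    by (intro exI[of _ "S x"]) auto
qed

lemma loop_reps_imp_measurably_equivalent:
  fixes A :: "('m::second_countable_topology, 'e::euclidean_space) chart set"
    and W\<^sub>1 W\<^sub>2 :: "('m, 'k::complex_hilbert_space) transport"
  assumes A: "smooth_atlas A" and conn: "connected (UNIV :: 'm set)"
    and sep: "separable_space (euclidean :: 'k topology)"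
    and W: "transport_system W\<^sub>1" "transport_system W\<^sub>2"
    and meas: "weakly_measurable_transport A W\<^sub>1" "weakly_measurable_transport A W\<^sub>2"
    and eq: "loop_reps_equivalent_at W\<^sub>1 W\<^sub>2 x\<^sub>0"
  shows "measurably_equivalent A W\<^sub>1 W\<^sub>2"
proof -
  obtain V where V: "unitary V"
    "\<And>c. c \<in> path_classes x\<^sub>0 x\<^sub>0 \<Longrightarrow> W\<^sub>2 x\<^sub>0 x\<^sub>0 c = V \<circ> W\<^sub>1 x\<^sub>0 x\<^sub>0 c \<circ> inv_op V"
    using eq by (auto simp: loop_reps_equivalent_at_def loop_rep_def pi1_def)
  have "\<exists>\<gamma>. path \<gamma> \<and> pathstart \<gamma> = x\<^sub>0 \<and> pathfinish \<gamma> = z" for z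
    using connected_manifold_path[OF A conn] by blast
  \<comment> \<open>An arbitrary choice for each \<open>z\<close>; measurability of \<open>S\<close>
    is derived later from \<open>SW\<close> alone.\<close>
  then obtain \<gamma> where \<gamma>: "\<And>z. path (\<gamma> z)" "\<And>z. pathstart (\<gamma> z) = x\<^sub>0" "\<And>z. pathfinish (\<gamma> z) = z"
    by metis
  define g where "g z = homotopy_class (\<gamma> z)" for z
  define g' where "g' z = homotopy_class (reversepath (\<gamma> z))" for z
  have g: "g z \<in> path_classes x\<^sub>0 z" and g': "g' z \<in> path_classes z x\<^sub>0" for z
    using path_classesI[OF \<gamma>(1)] reversepath_class[OF \<gamma>(1)] \<gamma>(2,3) by (metis g_def, metis g'_def)
  have inv: "inv_op (W z x\<^sub>0 (g z)) = W x\<^sub>0 z (g' z)" if "transport_system W" for W :: "('m, 'k) transport" and z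
    unfolding g_def g'_def by (rule transport_inv[OF that \<gamma>])
  have cancel: "W z x\<^sub>0 (g z) \<circ> W x\<^sub>0 z (g' z) = id" "W x\<^sub>0 z (g' z) \<circ> W z x\<^sub>0 (g z) = id"
    if "transport_system W" for W :: "('m, 'k) transport" and z
    using inv_op_comp[OF transport_unitary[OF that g]] by (simp_all only: inv[OF that])
  define S where "S z = W\<^sub>2 z x\<^sub>0 (g z) \<circ> V \<circ> W\<^sub>1 x\<^sub>0 z (g' z)" for z
  have S: "unitary (S z)" for z
    unfolding S_def by (intro unitary_comp V(1) transport_unitary[OF W(1) g'] transport_unitary[OF W(2) g])
  have SW: "W\<^sub>2 y x c \<circ> S x = S y \<circ> W\<^sub>1 y x c" if c: "c \<in> path_classes x y" for x y c
  proof -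
    \<comment> \<open>Closing \<open>c\<close> up to a loop at the base point by the chosen paths
      turns the assumption on \<open>V\<close> into the intertwining relation along
      \<open>c\<close>.\<close>
    define l where "l = class_comp (g' y) (class_comp c (g x))"
    have l: "l \<in> path_classes x\<^sub>0 x\<^sub>0"
      unfolding l_def by (intro class_comp_closed[OF g'] class_comp_closed[OF c] g)
    have loop: "W x\<^sub>0 x\<^sub>0 l = W x\<^sub>0 y (g' y) \<circ> (W y x c \<circ> W x x\<^sub>0 (g x))"
      if "transport_system W" for W :: "('m, 'k) transport"
      unfolding l_def transport_comp[OF that c g] by (rule transport_comp[OF that g' class_comp_closed[OF c g], symmetric])
    have "W\<^sub>2 x\<^sub>0 x\<^sub>0 l \<circ> V = V \<circ> W\<^sub>1 x\<^sub>0 x\<^sub>0 l \<circ> (inv_op V \<circ> V)"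
      unfolding V(2)[OF l] by (simp only: comp_assoc)
    then have V_loop: "W\<^sub>2 x\<^sub>0 x\<^sub>0 l \<circ> V = V \<circ> W\<^sub>1 x\<^sub>0 x\<^sub>0 l"
      by (simp only: inv_op_comp(2)[OF V(1)] comp_id)
    have "W\<^sub>2 y x c \<circ> S x =
        (W\<^sub>2 y x\<^sub>0 (g y) \<circ> W\<^sub>2 x\<^sub>0 y (g' y)) \<circ> W\<^sub>2 y x c \<circ> W\<^sub>2 x x\<^sub>0 (g x) \<circ> V \<circ> W\<^sub>1 x\<^sub>0 x (g' x)"
      unfolding cancel[OF W(2)] S_def by (simp only: id_comp comp_assoc)
    also have "\<dots> = W\<^sub>2 y x\<^sub>0 (g y) \<circ> (W\<^sub>2 x\<^sub>0 x\<^sub>0 l \<circ> V) \<circ> W\<^sub>1 x\<^sub>0 x (g' x)"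
      unfolding loop[OF W(2)] by (simp only: comp_assoc)
    also have "\<dots> = W\<^sub>2 y x\<^sub>0 (g y) \<circ> V \<circ> W\<^sub>1 x\<^sub>0 y (g' y) \<circ> W\<^sub>1 y x c \<circ> (W\<^sub>1 x x\<^sub>0 (g x) \<circ> W\<^sub>1 x\<^sub>0 x (g' x))"
      unfolding V_loop loop[OF W(1)] by (simp only: comp_assoc)
    also have "\<dots> = S y \<circ> W\<^sub>1 y x c"
      unfolding cancel[OF W(1)] S_def by (simp only: comp_id)
    finally show ?thesis .
  qed
  have "W\<^sub>2 y x c = S y \<circ> W\<^sub>1 y x c \<circ> inv_op (S x)" if c: "c \<in> path_classes x y" for x y c
  proof -
    have "W\<^sub>2 y x c = W\<^sub>2 y x c \<circ> S x \<circ> inv_op (S x)"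
      by (simp only: comp_assoc inv_op_comp(1)[OF S] comp_id)
    then show ?thesis by (simp only: SW[OF c])
  qed
  moreover have "weakly_measurable A S"
    by (rule intertwiner_weakly_measurable[OF sep A W meas S SW])
  ultimately show ?thesis using S unfolding measurably_equivalent_def by blast
qed

lemma conjugate_conjugate:
  assumes "unitary P" "unitary V"
  shows "P \<circ> (V \<circ> X \<circ> inv_op V) \<circ> inv_op P = (P \<circ> V) \<circ> X \<circ> inv_op (P \<circ> V)"
proof -
  have "inv_op (P \<circ> V) = inv_op V \<circ> inv_op P"
    using assms by (intro o_inv_distrib unitary_bij)
  then show ?thesis by (simp only: comp_assoc)
qed

lemma conjugate_eqD:
  assumes V: "unitary V" and "Y = V \<circ> X \<circ> inv_op V"
  shows "X = inv_op V \<circ> Y \<circ> inv_op (inv_op V)"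
proof -
  have "inv_op (inv_op V) = V" using V by (simp add: inv_inv_eq unitary_bij)
  then have "inv_op V \<circ> Y \<circ> inv_op (inv_op V) = (inv_op V \<circ> V) \<circ> X \<circ> (inv_op V \<circ> V)"
    unfolding assms(2) by (simp only: comp_assoc)
  also have "\<dots> = X" unfolding inv_op_comp(2)[OF V] by simp
  finally show ?thesis by simp
qed

lemma loop_reps_equivalent_sym:
  assumes "loop_reps_equivalent_at W\<^sub>1 W\<^sub>2 x"
  shows "loop_reps_equivalent_at W\<^sub>2 W\<^sub>1 x"
proof -
  obtain V where V: "unitary V"
    "\<And>c. c \<in> carrier (pi1 x) \<Longrightarrow> loop_rep W\<^sub>2 x c = V \<circ> loop_rep W\<^sub>1 x c \<circ> inv_op V"
    using assms by (auto simp: loop_reps_equivalent_at_def)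
  then show ?thesis
    unfolding loop_reps_equivalent_at_def
    by (intro exI[of _ "inv_op V"] conjI ballI unitary_inv_op conjugate_eqD) auto
qed

text \<open>The connecting path \<open>\<delta>\<close> is kept; only the conjugating unitary
  changes, from \<open>P\<close> to \<open>P \<circ> V\<close>.\<close>

lemma loop_rep_class_subset:
  assumes W: "transport_system W\<^sub>1" "transport_system W\<^sub>2"
    and eq: "\<And>x. loop_reps_equivalent_at W\<^sub>1 W\<^sub>2 x"
  shows "loop_rep_class W\<^sub>2 \<subseteq> loop_rep_class W\<^sub>1"
proof
  fix p assume "p \<in> loop_rep_class W\<^sub>2"
  then obtain x x' R' where p: "p = (x', R')" and "((x, loop_rep W\<^sub>2 x), (x', R')) \<in> rep_equiv"
    by (cases p) (auto simp: loop_rep_class_def)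
  then obtain \<delta> P where P: "(x', R') \<in> based_reps" "path \<delta>" "pathstart \<delta> = x'" "pathfinish \<delta> = x"
    "unitary P" "\<And>c. c \<in> carrier (pi1 x) \<Longrightarrow> R' (change_base \<delta> c) = P \<circ> loop_rep W\<^sub>2 x c \<circ> inv_op P"
    by (auto simp: rep_equiv_def)
  obtain V where V: "unitary V"
    "\<And>c. c \<in> carrier (pi1 x) \<Longrightarrow> loop_rep W\<^sub>2 x c = V \<circ> loop_rep W\<^sub>1 x c \<circ> inv_op V"
    using eq[of x] by (auto simp: loop_reps_equivalent_at_def)
  have "R' (change_base \<delta> c) = (P \<circ> V) \<circ> loop_rep W\<^sub>1 x c \<circ> inv_op (P \<circ> V)" if "c \<in> carrier (pi1 x)" for c
    unfolding P(6)[OF that] V(2)[OF that] by (rule conjugate_conjugate[OF P(5) V(1)])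
  then have "((x, loop_rep W\<^sub>1 x), (x', R')) \<in> rep_equiv"
    using P(1-4) loop_rep_hom[OF W(1), of x] unitary_comp[OF P(5) V(1)]
    unfolding rep_equiv_def based_reps_def by blast
  then show "p \<in> loop_rep_class W\<^sub>1" unfolding loop_rep_class_def p by blast
qed

text \<open>Equality of classes yields an equivalence with the second system at some other base
  point \<open>x'\<close>, along some \<open>\<delta>\<close>. Transport of the second system back
  along \<open>\<delta>\<close> brings it to \<open>x\<close>, where no path remains.\<close>

lemma loop_rep_class_eqD:
  fixes W\<^sub>1 W\<^sub>2 :: "('m::topological_space, 'k::complex_hilbert_space) transport"
  assumes W: "transport_system W\<^sub>1" "transport_system W\<^sub>2" and eq: "loop_rep_class W\<^sub>1 = loop_rep_class W\<^sub>2"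
  shows "loop_reps_equivalent_at W\<^sub>1 W\<^sub>2 x"
proof (rule loop_reps_equivalent_sym)
  have "((x, loop_rep W\<^sub>1 x), (x, loop_rep W\<^sub>1 x)) \<in> rep_equiv"
    by (rule loop_rep_equiv[OF W(1), of "\<lambda>_. x"]) (simp_all add: path_def pathstart_def pathfinish_def)
  then have "(x, loop_rep W\<^sub>1 x) \<in> loop_rep_class W\<^sub>2"
    unfolding eq[symmetric] unfolding loop_rep_class_def by (rule ImageI) (rule rangeI)
  then obtain x' where "((x', loop_rep W\<^sub>2 x'), (x, loop_rep W\<^sub>1 x)) \<in> rep_equiv"
    by (auto simp: loop_rep_class_def)
  then obtain \<delta> P where \<delta>: "path \<delta>" "pathstart \<delta> = x" "pathfinish \<delta> = x'" and P: "unitary P"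
    "\<And>c. c \<in> path_classes x' x' \<Longrightarrow> loop_rep W\<^sub>1 x (change_base \<delta> c) = P \<circ> loop_rep W\<^sub>2 x' c \<circ> inv_op P"
    by (auto simp: rep_equiv_def pi1_def)
  define T where "T = W\<^sub>2 x x' (homotopy_class (reversepath \<delta>))"
  have T: "unitary T"
    unfolding T_def using reversepath_class[OF \<delta>(1)] \<delta> by (intro transport_unitary[OF W(2)]) simp
  have "loop_rep W\<^sub>1 x c = (P \<circ> inv_op T) \<circ> loop_rep W\<^sub>2 x c \<circ> inv_op (P \<circ> inv_op T)"
    if c: "c \<in> path_classes x x" for c
  proof -
    \<comment> \<open>A preimage of \<open>c\<close> under \<open>change_base \<delta>\<close>, the
      only form of loop for which the equivalence gives an equation.\<close>
    define b where "b = change_base (reversepath \<delta>) c"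
    have b: "b \<in> path_classes x' x'"
      using change_base_closed[of "reversepath \<delta>" c] \<delta> c by (simp add: b_def)
    have cb: "change_base \<delta> b = c"
      using change_base_reversepath[OF \<delta>(1), of c] \<delta> c by (simp add: b_def)
    have "loop_rep W\<^sub>2 x c = T \<circ> loop_rep W\<^sub>2 x' b \<circ> inv_op T"
      using loop_rep_change_base[OF W(2) \<delta> b] unfolding cb T_def .
    then have "loop_rep W\<^sub>2 x' b = inv_op T \<circ> loop_rep W\<^sub>2 x c \<circ> inv_op (inv_op T)"
      by (rule conjugate_eqD[OF T])
    then have "loop_rep W\<^sub>1 x c = P \<circ> (inv_op T \<circ> loop_rep W\<^sub>2 x c \<circ> inv_op (inv_op T)) \<circ> inv_op P"
      using P(2)[OF b] unfolding cb by simp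
    also have "\<dots> = (P \<circ> inv_op T) \<circ> loop_rep W\<^sub>2 x c \<circ> inv_op (P \<circ> inv_op T)"
      by (rule conjugate_conjugate[OF P(1) unitary_inv_op[OF T]])
    finally show ?thesis .
  qed
  then show "loop_reps_equivalent_at W\<^sub>2 W\<^sub>1 x"
    unfolding loop_reps_equivalent_at_def pi1_def using unitary_comp[OF P(1) unitary_inv_op[OF T]] by auto
qed

theorem lemma2p7:
  fixes A :: "('m::{t2_space,second_countable_topology}, real ^ 'n) chart set"
  assumes "smooth_atlas A"
    and "connected (UNIV :: 'm set)"
    and "separable_space (euclidean :: 'k::complex_hilbert_space topology)"
  shows
    "(\<forall>w :: 'm set \<Rightarrow> 'm \<Rightarrow> 'm \<Rightarrow> 'k \<Rightarrow> 'k. local_system A w \<longrightarrow>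
        (\<exists>W :: ('m, 'k) transport.
           (\<forall>x y g. regular_path A g \<and> pathstart g = x \<and> pathfinish g = y \<longrightarrow>
              (\<exists>n t R. small_subdivision A g n t R) \<and>
              (\<forall>n t R. small_subdivision A g n t R \<longrightarrow>
                 path_product w g t R n = W y x (homotopy_class g))) \<and>
           transport_system W \<and>
           almost_all A (\<lambda>x. loop_rep W x \<in> hom (pi1 x) unitary_group) \<and>
           (\<exists>C \<in> based_reps // rep_equiv. almost_all A (\<lambda>x. (x, loop_rep W x) \<in> C)))) \<and>
     (\<forall>W\<^sub>1 W\<^sub>2 :: ('m, 'k) transport.
        transport_system W\<^sub>1 \<longrightarrow> transport_system W\<^sub>2 \<longrightarrow>
        weakly_measurable_transport A W\<^sub>1 \<longrightarrow> weakly_measurable_transport A W\<^sub>2 \<longrightarrow>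
        (measurably_equivalent A W\<^sub>1 W\<^sub>2 \<longleftrightarrow> (\<exists>x. loop_reps_equivalent_at W\<^sub>1 W\<^sub>2 x)) \<and>
        (measurably_equivalent A W\<^sub>1 W\<^sub>2 \<longleftrightarrow> (\<forall>x. loop_reps_equivalent_at W\<^sub>1 W\<^sub>2 x)) \<and>
        (measurably_equivalent A W\<^sub>1 W\<^sub>2 \<longleftrightarrow> loop_rep_class W\<^sub>1 = loop_rep_class W\<^sub>2))"
proof (intro conjI allI impI)
  \<comment> \<open>Both almost-everywhere claims are obtained at every point, with empty
    exceptional set.\<close>
  have all: "almost_all A P" if "\<And>x. P x" for P
    using that by (auto simp: almost_all_def lebesgue_null_def)
  fix w :: "'m set \<Rightarrow> 'm \<Rightarrow> 'm \<Rightarrow> 'k \<Rightarrow> 'k"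
  assume w: "local_system A w"
  obtain W where W: "transport_system W"
    and sub: "\<And>g. path g \<Longrightarrow> \<exists>n t R. small_subdivision A g n t R"
    and prod: "\<And>g n t R. path g \<Longrightarrow> small_subdivision A g n t R \<Longrightarrow>
      path_product w g t R n = W (pathfinish g) (pathstart g) (homotopy_class g)"
    using local_system_transport[OF assms(1) w] by blast
  show "\<exists>W :: ('m, 'k) transport.
      (\<forall>x y g. regular_path A g \<and> pathstart g = x \<and> pathfinish g = y \<longrightarrow>
         (\<exists>n t R. small_subdivision A g n t R) \<and>
         (\<forall>n t R. small_subdivision A g n t R \<longrightarrow> path_product w g t R n = W y x (homotopy_class g))) \<and>
      transport_system W \<and>
      almost_all A (\<lambda>x. loop_rep W x \<in> hom (pi1 x) unitary_group) \<and>
      (\<exists>C \<in> based_reps // rep_equiv. almost_all A (\<lambda>x. (x, loop_rep W x) \<in> C))"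
  proof (intro exI[of _ W] conjI)
    show "\<forall>x y g. regular_path A g \<and> pathstart g = x \<and> pathfinish g = y \<longrightarrow>
        (\<exists>n t R. small_subdivision A g n t R) \<and>
        (\<forall>n t R. small_subdivision A g n t R \<longrightarrow> path_product w g t R n = W y x (homotopy_class g))"
    proof (intro allI impI)
      fix x y g assume g: "regular_path A g \<and> pathstart g = x \<and> pathfinish g = y"
      then have "path g" by (simp add: regular_path_def)
      then show "(\<exists>n t R. small_subdivision A g n t R) \<and>
          (\<forall>n t R. small_subdivision A g n t R \<longrightarrow> path_product w g t R n = W y x (homotopy_class g))"
        using sub prod g by blast
    qed
    show "transport_system W" by (rule W)
    show "almost_all A (\<lambda>x. loop_rep W x \<in> hom (pi1 x) unitary_group)"
      by (intro all loop_rep_hom W)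
    \<comment> \<open>The class \<open>C\<close> is that of the loop representation at an arbitrary
      point; paths from the other points carry their representations into it.\<close>
    fix x\<^sub>0 :: 'm
    show "\<exists>C \<in> based_reps // rep_equiv. almost_all A (\<lambda>x. (x, loop_rep W x) \<in> C)"
    proof (intro bexI all)
      fix x
      obtain \<delta> where "path \<delta>" "pathstart \<delta> = x" "pathfinish \<delta> = x\<^sub>0"
        using connected_manifold_path[OF assms(1,2)] .
      from loop_rep_equiv[OF W this] show "(x, loop_rep W x) \<in> rep_equiv `` {(x\<^sub>0, loop_rep W x\<^sub>0)}"
        by simp
    next
      have "(x\<^sub>0, loop_rep W x\<^sub>0) \<in> based_reps" using loop_rep_hom[OF W] by (simp add: based_reps_def)
      then show "rep_equiv `` {(x\<^sub>0, loop_rep W x\<^sub>0)} \<in> based_reps // rep_equiv" by (rule quotientI)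
    qed
  qed
next
  fix W\<^sub>1 W\<^sub>2 :: "('m, 'k) transport"
  assume W: "transport_system W\<^sub>1" "transport_system W\<^sub>2"
    and meas: "weakly_measurable_transport A W\<^sub>1" "weakly_measurable_transport A W\<^sub>2"
  note to_loop = measurably_equivalent_imp_loop_reps[of A W\<^sub>1 W\<^sub>2]
  note from_loop = loop_reps_imp_measurably_equivalent[OF assms W meas]
  show "measurably_equivalent A W\<^sub>1 W\<^sub>2 \<longleftrightarrow> (\<exists>x. loop_reps_equivalent_at W\<^sub>1 W\<^sub>2 x)"
    using to_loop from_loop by blast
  show "measurably_equivalent A W\<^sub>1 W\<^sub>2 \<longleftrightarrow> (\<forall>x. loop_reps_equivalent_at W\<^sub>1 W\<^sub>2 x)"
    using to_loop from_loop by blast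
  show "measurably_equivalent A W\<^sub>1 W\<^sub>2 \<longleftrightarrow> loop_rep_class W\<^sub>1 = loop_rep_class W\<^sub>2"
  proof
    assume "measurably_equivalent A W\<^sub>1 W\<^sub>2"
    note eq = to_loop[OF this]
    show "loop_rep_class W\<^sub>1 = loop_rep_class W\<^sub>2"
      by (rule subset_antisym[OF loop_rep_class_subset[OF W(2,1) loop_reps_equivalent_sym[OF eq]]
            loop_rep_class_subset[OF W eq]])
  next
    assume "loop_rep_class W\<^sub>1 = loop_rep_class W\<^sub>2"
    from loop_rep_class_eqD[OF W this] show "measurably_equivalent A W\<^sub>1 W\<^sub>2" by (rule from_loop)
  qed
qed

end
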